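(* Let $\beta\in[0,2]$ and $\chi\in(0,1]$. Let $Y_0$ be $\mathbb Z_+$-valued with $\mathbf P(Y_0\ge2)>0$, $\Lambda:=\mathbf E(Y_0^3m^{Y_0})<\infty$ and $(m-1)\mathbf E(Y_0m^{Y_0})=\mathbf E(m^{Y_0})$, and assume the system $(Y_n)$ is $\beta$-regular with coefficient $\chi$. Let $X_0$ be $\mathbb Z_+$-valued with $\mathbf P(X_0=k)\ge\mathbf P(Y_0=k)$ for all integers $k\ge1$, and let $(X_n)$ be the recursive system started from $X_0$. There exists a constant $c_{40}>0$, depending only on $m$ and $\beta$, such that if $\mathbf E(X_0)-\mathbf E(Y_0)\ge\eta$ for some $\eta\in(0,\frac{1}{3(m-1)}]$, then, with $R:=\frac{\Lambda}{\eta\chi\mathbf P(Y_0=0)}$, $$\max_{0\le j\le n_0}\mathbf E(X_j)\ge2,\qquad n_0:=\Big\lfloor\frac{c_{40}}{[\chi^3\mathbf P(Y_0=0)]^{1/2}}\max\{\Lambda(R\log R)^{(1-\beta)/2},(R\log R)^{1/2}\}\log R\Big\rfloor;$$ in particular, the free energy $F^X_\infty$ of $(X_n)$ satisfies $$F_\infty^X\ge\exp\Big[-\frac{c_{41}}{[\chi^3\mathbf P(Y_0=0)]^{1/2}}\max\{\Lambda(R\log R)^{(1-\beta)/2},(R\log R)^{1/2}\}\log R\Big]$$ for a constant $c_{41}>0$ depending only on $m$ and $\beta$.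
   Context: Fix an integer $m\ge2$. Recursive system: $Z_{n+1}$ has the law of $(Z_{n,1}+\cdots+Z_{n,m}-1)^+$ with $Z_{n,i}$ independent copies of $Z_n$. Free energy $F_\infty^X:=\lim_{n\to\infty}\mathbf E(X_n)/m^n$. Regularity: for $\zeta$ $\mathbb Z_+$-valued with $\mathbf E(\zeta m^\zeta)<\infty$, $\mathbf P(\zeta\ge2)>0$, set $\Lambda(\zeta):=\mathbf E(\zeta^3m^\zeta)\in(0,\infty]$, $\Xi_k(\zeta):=\mathbf E[(\zeta\wedge k)^2((m-1)\zeta-1)m^\zeta]$; $\zeta$ (and the system started from it) is $\beta$-regular with coefficient $\chi$ if $\Xi_k(\zeta)\ge\chi\min\{\Lambda(\zeta),k^\beta\}$ for all integers $k\ge1$. *)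

theory Defs
  imports "HOL-Probability.Probability"
begin

text \<open>Laws of Z_+-valued random variables are represented as nat pmfs.\<close>

definition conv_pmf :: "nat pmf \<Rightarrow> nat pmf \<Rightarrow> nat pmf" where
  "conv_pmf p q = bind_pmf p (\<lambda>x. map_pmf (\<lambda>y. x + y) q)"

fun sum_copies :: "nat \<Rightarrow> nat pmf \<Rightarrow> nat pmf" where
  "sum_copies 0 p = return_pmf 0"
| "sum_copies (Suc n) p = conv_pmf p (sum_copies n p)"

text \<open>One step of the recursive system: law of (Z_1+...+Z_m - 1)^+ (truncated nat subtraction).\<close>
definition rs_step :: "nat \<Rightarrow> nat pmf \<Rightarrow> nat pmf" where
  "rs_step m p = map_pmf (\<lambda>s. s - 1) (sum_copies m p)"

definition rs :: "nat \<Rightarrow> nat pmf \<Rightarrow> nat \<Rightarrow> nat pmf" where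
  "rs m p n = (rs_step m ^^ n) p"

definition Enat :: "nat pmf \<Rightarrow> ennreal" where
  "Enat p = (\<integral>\<^sup>+ k. ennreal (real k) \<partial>measure_pmf p)"

definition free_energy :: "nat \<Rightarrow> nat pmf \<Rightarrow> ennreal" where
  "free_energy m p = lim (\<lambda>n. Enat (rs m p n) / ennreal (real m ^ n))"

definition Lambda :: "nat \<Rightarrow> nat pmf \<Rightarrow> ennreal" where
  "Lambda m p = (\<integral>\<^sup>+ z. ennreal (real z ^ 3 * real m ^ z) \<partial>measure_pmf p)"

definition Xi :: "nat \<Rightarrow> nat pmf \<Rightarrow> nat \<Rightarrow> real" where
  "Xi m p k = measure_pmf.expectation p
     (\<lambda>z. real (min z k) ^ 2 * ((real m - 1) * real z - 1) * real m ^ z)"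

text \<open>beta-regularity with coefficient chi (including the standing assumptions
  E(zeta m^zeta) < \<infinity> and P(zeta \<ge> 2) > 0). min{\<infinity>, k^beta} = k^beta.\<close>
definition regular :: "nat \<Rightarrow> real \<Rightarrow> real \<Rightarrow> nat pmf \<Rightarrow> bool" where
  "regular m \<beta> chi p \<longleftrightarrow>
     (\<integral>\<^sup>+ z. ennreal (real z * real m ^ z) \<partial>measure_pmf p) < \<infinity> \<and>
     measure_pmf.prob p {2..} > 0 \<and>
     (\<forall>k::nat. k \<ge> 1 \<longrightarrow>
        Xi m p k \<ge> chi * (if Lambda m p = \<infinity> then real k powr \<beta>
                           else min (enn2real (Lambda m p)) (real k powr \<beta>)))"

end

theory Submission
  imports Defs "HOL-Real_Asymp.Real_Asymp"
begin

text \<open>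
  Call a law critical if \<open>(m - 1) E(Y m\<^sup>Y) = E(m\<^sup>Y)\<close>; this is preserved by the recursion.
  Attach marks \<open>N\<close> to the leaves of a critical system with \<open>Y = 0\<close>, and let the marks of a vertex
  be transmitted to its parent unless all its siblings and itself have value \<open>0\<close>. If the marks
  are the surplus of \<open>X\<^sub>0\<close> over \<open>Y\<^sub>0\<close>, then \<open>Y\<^sub>n + N\<^sub>n \<le> X\<^sub>n\<close> stochastically, and
  \<open>E(m\<^sup>Y (1 + Y) N)\<close> is multiplied by \<open>E(m\<^sup>Y)\<^bsup>m-1\<^esup>\<close> at each step, so it grows like
  \<open>P n = \<Prod>i<n. E(m\<^bsup>Y\<^sub>i\<^esup>)\<^bsup>m-1\<^esup>\<close>. The recursions of the second and third moments under the
  weight \<open>m\<^sup>Y\<close> and the Cauchy-Schwarz inequality show \<open>P n \<ge> c n\<^sup>2 / \<Lambda>\<close>.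

  Since \<open>E(X\<^bsub>n+1\<^esub> - t)\<^sup>+ \<ge> m E(X\<^sub>n - t - 1)\<^sup>+\<close>, we have \<open>E(X\<^bsub>n+t\<^esub>) \<ge> m\<^sup>t E(X\<^sub>n - t)\<^sup>+\<close>. If all
  means up to the time horizon are below \<open>2\<close>, it follows that the event \<open>N\<^sub>n \<ge> r\<close>, with \<open>r\<close> a
  large multiple of \<open>ln R\<close>, carries only a tiny part of the weight \<open>m\<^sup>Y (1 + Y)\<close>. Capping the marks
  at \<open>r\<close> is then harmless, and \<open>P n E(N\<^sub>0) \<le> C r\<close> contradicts the quadratic growth of \<open>P\<close> for \<open>n\<close> of
  order \<open>sqrt (R ln R)\<close>. Large values of \<open>Y\<^sub>n\<close> are controlled by an exponential moment at
  \<open>m (1 + \<epsilon>)\<close> with \<open>\<epsilon>\<close> of order \<open>1 / n\<close>; for this \<open>Y\<^sub>0\<close> is first cut off at height of order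
  \<open>n\<close>, criticality being restored by moving a part of the surplus of \<open>X\<^sub>0\<close> to \<open>Y\<^sub>0\<close>.
\<close>

section \<open>Exponentially tilted moments of sums of independent marked variables\<close>

definition add_pmf :: "(nat \<times> nat) pmf \<Rightarrow> (nat \<times> nat) pmf \<Rightarrow> (nat \<times> nat) pmf" where
  "add_pmf a b = bind_pmf a (\<lambda>u. map_pmf (\<lambda>v. (fst u + fst v, snd u + snd v)) b)"

fun iid_sum :: "nat \<Rightarrow> (nat \<times> nat) pmf \<Rightarrow> (nat \<times> nat) pmf" where
  "iid_sum 0 a = return_pmf (0, 0)"
| "iid_sum (Suc n) a = add_pmf a (iid_sum n a)"

text \<open>If \<open>S \<ge> 1\<close>, the unit lost in a step is charged to the values and the
  marks survive up to the cap \<open>r\<close>; if \<open>S = 0\<close>, they are dropped. Either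
  way new value plus new mark is at most the truncated \<open>S + T - 1\<close>, as domination by
  the recursive system requires.\<close>

definition marked_step :: "nat \<Rightarrow> nat \<Rightarrow> (nat \<times> nat) pmf \<Rightarrow> (nat \<times> nat) pmf" where
  "marked_step m r a =
     map_pmf (\<lambda>(S, T). (S - 1, if S = 0 then 0 else min T r)) (iid_sum m a)"

abbreviation (input) "expec \<equiv> measure_pmf.expectation"

section \<open>Expectations over finitely supported laws of pairs\<close>

lemma integrable_finite_pmf:
  fixes f :: "'a \<Rightarrow> real"
  shows "finite (set_pmf a) \<Longrightarrow> integrable (measure_pmf a) f"
  by (rule integrable_measure_pmf_finite)

lemma finite_set_add_pmf:
  "finite (set_pmf a) \<Longrightarrow> finite (set_pmf b) \<Longrightarrow> finite (set_pmf (add_pmf a b))"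
  by (simp add: add_pmf_def)

lemma finite_set_iid_sum: "finite (set_pmf a) \<Longrightarrow> finite (set_pmf (iid_sum n a))"
  by (induction n) (simp_all add: finite_set_add_pmf)

lemma finite_set_marked_step:
  "finite (set_pmf a) \<Longrightarrow> finite (set_pmf (marked_step m r a))"
  by (simp add: marked_step_def finite_set_iid_sum)

lemma expec_add_pmf:
  fixes h :: "nat \<times> nat \<Rightarrow> real"
  assumes "finite (set_pmf a)" "finite (set_pmf b)"
  shows "expec (add_pmf a b) h =
    expec a (\<lambda>u. expec b (\<lambda>v. h (fst u + fst v, snd u + snd v)))"
proof -
  have "expec (add_pmf a b) h = (\<Sum>u\<in>set_pmf a. pmf a u *\<^sub>R
      expec (map_pmf (\<lambda>v. (fst u + fst v, snd u + snd v)) b) h)"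
    unfolding add_pmf_def using assms by (intro pmf_expectation_bind) auto
  also have "\<dots> = expec a (\<lambda>u. expec b (\<lambda>v. h (fst u + fst v, snd u + snd v)))"
    using assms by (subst (2) integral_measure_pmf[where A="set_pmf a"]) (auto simp: integral_map_pmf)
  finally show ?thesis .
qed

lemma expec_mono_finite:
  fixes f g :: "'a \<Rightarrow> real"
  assumes "finite (set_pmf a)" "\<And>u. u \<in> set_pmf a \<Longrightarrow> f u \<le> g u"
  shows "expec a f \<le> expec a g"
  using assms by (intro integral_mono_AE) (auto simp: integrable_finite_pmf AE_measure_pmf_iff)

text \<open>\<open>E(f(Y, N) s^Y)\<close> for a value \<open>Y\<close> and a mark \<open>N\<close>.
  The arguments of \<open>f\<close> are real, so that shifts of \<open>Y\<close> become polynomial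
  identities without truncated subtraction.\<close>

definition tmom :: "(nat \<times> nat) pmf \<Rightarrow> real \<Rightarrow> (real \<Rightarrow> real \<Rightarrow> real) \<Rightarrow> real" where
  "tmom a s f = expec a (\<lambda>u. f (real (fst u)) (real (snd u)) * s ^ fst u)"

lemma tmom_add:
  "finite (set_pmf a) \<Longrightarrow> tmom a s (\<lambda>y k. f y k + g y k) = tmom a s f + tmom a s g"
  unfolding tmom_def by (simp add: distrib_right integrable_finite_pmf)

lemma tmom_diff:
  "finite (set_pmf a) \<Longrightarrow> tmom a s (\<lambda>y k. f y k - g y k) = tmom a s f - tmom a s g"
  unfolding tmom_def by (simp add: left_diff_distrib integrable_finite_pmf)

lemma tmom_cmult: "tmom a s (\<lambda>y k. c * f y k) = c * tmom a s f"
  unfolding tmom_def by (simp add: mult.assoc)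

lemma tmom_mono:
  assumes "finite (set_pmf a)" "s \<ge> 0"
    "\<And>y k. (y, k) \<in> set_pmf a \<Longrightarrow> f (real y) (real k) \<le> g (real y) (real k)"
  shows "tmom a s f \<le> tmom a s g"
  unfolding tmom_def using assms by (intro expec_mono_finite) (auto intro!: mult_right_mono)

lemma tmom_add_pmf:
  assumes "finite (set_pmf a)" "finite (set_pmf b)"
  shows "tmom (add_pmf a b) s f =
    tmom a s (\<lambda>y k. tmom b s (\<lambda>y' k'. f (y + y') (k + k')))"
proof -
  have "tmom (add_pmf a b) s f = expec a (\<lambda>u. expec b (\<lambda>v.
      f (real (fst u) + real (fst v)) (real (snd u) + real (snd v)) * s ^ (fst u + fst v)))"
    unfolding tmom_def by (simp add: expec_add_pmf assms)
  also have "\<dots> = expec a (\<lambda>u. expec b (\<lambda>v.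
      f (real (fst u) + real (fst v)) (real (snd u) + real (snd v)) * s ^ fst v) * s ^ fst u)"
    by (simp add: power_add mult.assoc mult.left_commute flip: integral_mult_right_zero)
      (simp add: mult.commute mult.left_commute)
  finally show ?thesis unfolding tmom_def .
qed

text \<open>Independence factorises each product. Four products suffice because the third falling
  factorial of a sum has four terms in its Vandermonde expansion.\<close>

lemma tmom_add_pmf_prod:
  assumes fin: "finite (set_pmf a)" "finite (set_pmf b)"
    and eq: "\<And>y k y' k'. f (y + y') (k + k') =
      p1 y k * q1 y' k' + p2 y k * q2 y' k' + p3 y k * q3 y' k' + p4 y k * q4 y' k'"
  shows "tmom (add_pmf a b) s f = tmom a s p1 * tmom b s q1 + tmom a s p2 * tmom b s q2
    + tmom a s p3 * tmom b s q3 + tmom a s p4 * tmom b s q4"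
proof -
  have mult_right: "tmom a s (\<lambda>y k. h y k * c) = tmom a s h * c" for h c
    using tmom_cmult[of a s c h] by (simp add: mult.commute)
  show ?thesis
    by (simp only: tmom_add_pmf[OF fin] eq tmom_add[OF fin(1)] tmom_add[OF fin(2)] tmom_cmult mult_right)
qed

lemma tmom_zero: "tmom a s (\<lambda>y k. 0) = 0"
  by (simp add: tmom_def)

text \<open>Falling factorials of a sum expand over choices of distinct summands, whence the
  coefficients \<open>n\<close>, \<open>n (n - 1)\<close> and \<open>n (n - 1) (n - 2)\<close>. The
  claims share one induction because the higher moments need the lower ones.\<close>

lemma tmom_iid_sum:
  fixes a s
  assumes fin: "finite (set_pmf a)"
  defines "g \<equiv> tmom a s (\<lambda>y k. 1)"
  defines "h1 \<equiv> tmom a s (\<lambda>y k. y) / g"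
  defines "h2 \<equiv> tmom a s (\<lambda>y k. y * (y - 1)) / g"
  defines "h3 \<equiv> tmom a s (\<lambda>y k. y * (y - 1) * (y - 2)) / g"
  defines "c \<equiv> tmom a s (\<lambda>y k. k) / g"
  defines "d \<equiv> tmom a s (\<lambda>y k. y * k) / g"
  assumes g: "g > 0"
  shows "tmom (iid_sum n a) s (\<lambda>y k. 1) = g ^ n"
    and "tmom (iid_sum n a) s (\<lambda>y k. y) = g ^ n * (n * h1)"
    and "tmom (iid_sum n a) s (\<lambda>y k. y * (y - 1)) = g ^ n * (n * h2 + n * (real n - 1) * h1\<^sup>2)"
    and "tmom (iid_sum n a) s (\<lambda>y k. y * (y - 1) * (y - 2)) =
      g ^ n * (n * h3 + 3 * n * (real n - 1) * h2 * h1 + n * (real n - 1) * (real n - 2) * h1 ^ 3)"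
    and "tmom (iid_sum n a) s (\<lambda>y k. k) = g ^ n * (n * c)"
    and "tmom (iid_sum n a) s (\<lambda>y k. y * k) = g ^ n * (n * d + n * (real n - 1) * c * h1)"
proof (induction n)
  case 0
  {
    case 1 show ?case by (simp add: tmom_def)
  next
    case 2 show ?case by (simp add: tmom_def)
  next
    case 3 show ?case by (simp add: tmom_def)
  next
    case 4 show ?case by (simp add: tmom_def)
  next
    case 5 show ?case by (simp add: tmom_def)
  next
    case 6 show ?case by (simp add: tmom_def)
  }
next
  case (Suc n)
  note prod = tmom_add_pmf_prod[OF fin finite_set_iid_sum[OF fin, of n]]
  have eqs: "tmom a s (\<lambda>y k. 1) = g" "tmom a s (\<lambda>y k. y) = g * h1"
    "tmom a s (\<lambda>y k. y * (y - 1)) = g * h2"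
    "tmom a s (\<lambda>y k. y * (y - 1) * (y - 2)) = g * h3"
    "tmom a s (\<lambda>y k. k) = g * c" "tmom a s (\<lambda>y k. y * k) = g * d"
    using g by (simp_all add: h1_def h2_def h3_def c_def d_def g_def)
  {
    case 1
    show ?case
      using prod[of "\<lambda>y k. 1" "\<lambda>y k. 1" "\<lambda>y k. 1" "\<lambda>y k. 0" "\<lambda>y k. 0" "\<lambda>y k. 0" "\<lambda>y k. 0"
          "\<lambda>y k. 0" "\<lambda>y k. 0" s]
      by (simp add: Suc.IH eqs tmom_zero)
  next
    case 2
    show ?case
      using prod[of "\<lambda>y k. y" "\<lambda>y k. y" "\<lambda>y k. 1" "\<lambda>y k. 1" "\<lambda>y k. y" "\<lambda>y k. 0" "\<lambda>y k. 0"
          "\<lambda>y k. 0" "\<lambda>y k. 0" s]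
      by (simp add: Suc.IH eqs tmom_zero algebra_simps)
  next
    case 3
    have "tmom (add_pmf a (iid_sum n a)) s (\<lambda>y k. y * (y - 1)) =
      tmom a s (\<lambda>y k. y * (y - 1)) * tmom (iid_sum n a) s (\<lambda>y k. 1)
      + tmom a s (\<lambda>y k. 2 * y) * tmom (iid_sum n a) s (\<lambda>y k. y)
      + tmom a s (\<lambda>y k. 1) * tmom (iid_sum n a) s (\<lambda>y k. y * (y - 1))
      + tmom a s (\<lambda>y k. 0) * tmom (iid_sum n a) s (\<lambda>y k. 0)"
      by (rule prod) (simp add: algebra_simps)
    then show ?case
      by (simp add: Suc.IH eqs tmom_zero tmom_cmult) (simp add: algebra_simps power2_eq_square)
  next
    case 4
    have "tmom (add_pmf a (iid_sum n a)) s (\<lambda>y k. y * (y - 1) * (y - 2)) =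
      tmom a s (\<lambda>y k. y * (y - 1) * (y - 2)) * tmom (iid_sum n a) s (\<lambda>y k. 1)
      + tmom a s (\<lambda>y k. 3 * (y * (y - 1))) * tmom (iid_sum n a) s (\<lambda>y k. y)
      + tmom a s (\<lambda>y k. 3 * y) * tmom (iid_sum n a) s (\<lambda>y k. y * (y - 1))
      + tmom a s (\<lambda>y k. 1) * tmom (iid_sum n a) s (\<lambda>y k. y * (y - 1) * (y - 2))"
      by (rule prod) (simp add: algebra_simps)
    then show ?case
      by (simp add: Suc.IH eqs tmom_zero tmom_cmult)
        (simp add: algebra_simps power2_eq_square power3_eq_cube)
  next
    case 5
    show ?case
      using prod[of "\<lambda>y k. k" "\<lambda>y k. k" "\<lambda>y k. 1" "\<lambda>y k. 1" "\<lambda>y k. k" "\<lambda>y k. 0" "\<lambda>y k. 0"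
          "\<lambda>y k. 0" "\<lambda>y k. 0" s]
      by (simp add: Suc.IH eqs tmom_zero algebra_simps)
  next
    case 6
    have "tmom (add_pmf a (iid_sum n a)) s (\<lambda>y k. y * k) =
      tmom a s (\<lambda>y k. y * k) * tmom (iid_sum n a) s (\<lambda>y k. 1)
      + tmom a s (\<lambda>y k. y) * tmom (iid_sum n a) s (\<lambda>y k. k)
      + tmom a s (\<lambda>y k. k) * tmom (iid_sum n a) s (\<lambda>y k. y)
      + tmom a s (\<lambda>y k. 1) * tmom (iid_sum n a) s (\<lambda>y k. y * k)"
      by (rule prod) (simp add: algebra_simps)
    then show ?case
      by (simp add: Suc.IH eqs tmom_zero) (simp add: algebra_simps)
  }
qed

section \<open>One step of the marked recursion\<close>

lemma tmom_one_ge_1: "finite (set_pmf a) \<Longrightarrow> s \<ge> 1 \<Longrightarrow> tmom a s (\<lambda>y k. 1) \<ge> 1"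
  using expec_mono_finite[of a "\<lambda>_. 1" "\<lambda>u. s ^ fst u"] by (simp add: tmom_def)

text \<open>For \<open>S \<ge> 1\<close> the new weight \<open>s ^ (S - 1)\<close> is
  \<open>s ^ S / s\<close>. Only \<open>S = 0\<close> feels the truncation, and \<open>zero\<close>
  asks that \<open>F\<close> absorb it; the functions used below are chosen for that.\<close>

lemma tmom_marked_step:
  assumes s: "s > 0"
    and zero: "\<And>T::nat. f 0 0 = F 0 (real T) / s"
    and Suc: "\<And>S T::nat. f (real S) (min (real T) (real r)) = F (real S + 1) (real T)"
  shows "tmom (marked_step m r a) s f = tmom (iid_sum m a) s F / s"
proof -
  have "f (real (S - 1)) (real (if S = 0 then 0 else min T r)) * s ^ (S - 1) =
      F (real S) (real T) * s ^ S / s" for S T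
    using s zero[of T] Suc[of "S - 1" T] by (cases S) (auto simp: of_nat_min add.commute)
  then show ?thesis
    unfolding tmom_def marked_step_def
    by (simp add: integral_map_pmf case_prod_beta flip: integral_divide_zero)
qed

text \<open>Shifted by one, \<open>(s - 1) y - 1\<close> becomes \<open>(s - 1) S - s\<close>. At
  \<open>S = 0\<close> this is \<open>- s\<close>, which divided by \<open>s\<close> is the true
  value \<open>- 1\<close>, so the truncation at \<open>0\<close> is invisible.\<close>

definition psi_mom :: "(nat \<times> nat) pmf \<Rightarrow> real \<Rightarrow> real" where
  "psi_mom a s = tmom a s (\<lambda>y k. (s - 1) * y - 1)"

lemma psi_mom_eq:
  "finite (set_pmf a) \<Longrightarrow> psi_mom a s = (s - 1) * tmom a s (\<lambda>y k. y) - tmom a s (\<lambda>y k. 1)"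
  unfolding psi_mom_def by (simp add: tmom_diff tmom_cmult)

text \<open>The moment reproduces itself up to a term with factor \<open>1 - s / m\<close>. That
  term vanishes at \<open>s = m\<close>, which is why criticality is preserved.\<close>

lemma psi_mom_marked_step:
  fixes s :: real
  assumes fin: "finite (set_pmf a)" and s: "s \<ge> 1" and m: "m \<ge> 1"
  shows "psi_mom (marked_step m r a) s =
    real m / s * tmom a s (\<lambda>y k. 1) ^ (m - 1) * (psi_mom a s + (1 - s / m) * tmom a s (\<lambda>y k. 1))"
proof -
  let ?g = "tmom a s (\<lambda>y k. 1)" and ?h = "tmom a s (\<lambda>y k. y)"
  have g: "?g > 0" using tmom_one_ge_1[OF fin s] by simp
  have "psi_mom (marked_step m r a) s = tmom (iid_sum m a) s (\<lambda>y k. (s - 1) * y - s * 1) / s"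
    unfolding psi_mom_def using s by (intro tmom_marked_step) (auto simp: algebra_simps)
  also have "\<dots> = ((s - 1) * (?g ^ m * (m * (?h / ?g))) - s * ?g ^ m) / s"
    by (simp only: tmom_diff[OF finite_set_iid_sum[OF fin]] tmom_cmult tmom_iid_sum[OF fin g])
  also have "?g ^ m = ?g ^ (m - 1) * ?g"
    using m by (cases m) auto
  also have "((s - 1) * (?g ^ (m - 1) * ?g * (m * (?h / ?g))) - s * (?g ^ (m - 1) * ?g)) / s =
      real m / s * ?g ^ (m - 1) * ((s - 1) * ?h - ?g + (1 - s / m) * ?g)"
  proof -
    have "((s - 1) * (e * g * (M * (h / g))) - s * (e * g)) / s =
        M / s * e * ((s - 1) * h - g + (1 - s / M) * g)" if "g > 0" "M > 0" for e g h M :: real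
      using that s by (simp add: field_simps)
    then show ?thesis using g m by simp
  qed
  finally show ?thesis by (simp only: psi_mom_eq[OF fin])
qed

definition critical_law :: "nat \<Rightarrow> (nat \<times> nat) pmf \<Rightarrow> bool" where
  "critical_law m a \<longleftrightarrow> psi_mom a (real m) = 0"

lemma critical_law_iff:
  "finite (set_pmf a) \<Longrightarrow>
   critical_law m a \<longleftrightarrow> tmom a m (\<lambda>y k. 1) = (real m - 1) * tmom a m (\<lambda>y k. y)"
  by (auto simp: critical_law_def psi_mom_eq)

lemma critical_law_marked_step:
  "finite (set_pmf a) \<Longrightarrow> m \<ge> 2 \<Longrightarrow> critical_law m a \<Longrightarrow> critical_law m (marked_step m r a)"
  by (simp add: critical_law_def psi_mom_marked_step)

section \<open>Second and third moments at the critical weight\<close>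

text \<open>After the shift \<open>y (y + 1)\<close> becomes \<open>(S - 1) S\<close>, which
  vanishes at \<open>S = 0\<close>, so the truncation does no harm. The factor \<open>m - 1\<close>
  makes the loss inside the bracket of \<open>second_mom_marked_step\<close> exactly
  \<open>E(m^Y)\<close>.\<close>

definition second_mom :: "nat \<Rightarrow> (nat \<times> nat) pmf \<Rightarrow> real" where
  "second_mom m a = (real m - 1) * tmom a m (\<lambda>y k. y * (y + 1))"

text \<open>\<open>second_mom\<close> is added because its loss \<open>E(m^Y)\<close> in a step
  outweighs the gain \<open>(m - 2) / (m - 1)^2 * E(m^Y)\<close> of the cubic moment. The sum
  therefore grows by at most the factor \<open>E(m^Y)^(m - 1)\<close>.\<close>

definition third_mom :: "nat \<Rightarrow> (nat \<times> nat) pmf \<Rightarrow> real" where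
  "third_mom m a = tmom a m (\<lambda>y k. (y - 1) * y * (y + 1)) + second_mom m a"

lemma second_mom_marked_step:
  assumes fin: "finite (set_pmf a)" and m: "m \<ge> 2" and crit: "critical_law m a"
  shows "second_mom m (marked_step m r a) =
    tmom a m (\<lambda>y k. 1) ^ (m - 1) * (second_mom m a - tmom a m (\<lambda>y k. 1))"
proof -
  let ?g = "tmom a m (\<lambda>y k. 1)" and ?h = "tmom a m (\<lambda>y k. y)"
  and ?h2 = "tmom a m (\<lambda>y k. y * (y - 1))"
  have g: "?g > 0" using tmom_one_ge_1[OF fin, of m] m by simp
  have gh: "?g = (real m - 1) * ?h" using crit fin by (simp add: critical_law_iff)
  then have hg: "?h / ?g = 1 / (real m - 1)" using g m by (auto simp: field_simps)
  have "tmom (marked_step m r a) m (\<lambda>y k. y * (y + 1)) =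
      tmom (iid_sum m a) m (\<lambda>y k. y * (y - 1)) / m"
    using m by (intro tmom_marked_step) (auto simp: algebra_simps)
  also have "\<dots> = ?g ^ m * (m * (?h2 / ?g) + m * (real m - 1) * (1 / (real m - 1))\<^sup>2) / m"
    by (simp only: tmom_iid_sum[OF fin g] hg)
  also have "?g ^ m = ?g ^ (m - 1) * ?g"
    using m by (cases m) auto
  also have "?g ^ (m - 1) * ?g * (m * (?h2 / ?g) + m * (real m - 1) * (1 / (real m - 1))\<^sup>2) / m
    = ?g ^ (m - 1) * (?h2 + ?g / (real m - 1))"
  proof -
    have "g * (M * (h2 / g) + M * (M - 1) * (1 / (M - 1))\<^sup>2) / M = h2 + g / (M - 1)"
      if "g > 0" "M > 1" for g M h2 :: real
    proof -
      have "M * (M - 1) * (1 / (M - 1))\<^sup>2 = M * (1 / (M - 1))"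
        using that by (simp add: power2_eq_square)
      then show ?thesis using that by (simp add: distrib_left add_divide_distrib)
    qed
    from arg_cong[OF this[OF g, of "real m" ?h2], of "\<lambda>x. ?g ^ (m - 1) * x"] m
    show ?thesis by (simp only: mult.assoc times_divide_eq_right)
  qed
  also have "?g / (real m - 1) = ?h" using gh m by (simp add: field_simps)
  finally have 1: "tmom (marked_step m r a) m (\<lambda>y k. y * (y + 1)) = ?g ^ (m - 1) * (?h2 + ?h)" .
  have "tmom a m (\<lambda>y k. y * (y + 1)) = tmom a m (\<lambda>y k. y * (y - 1) + 2 * y)"
    by (simp add: algebra_simps)
  also have "\<dots> = ?h2 + 2 * ?h" by (simp only: tmom_add[OF fin] tmom_cmult)
  finally have 2: "tmom a m (\<lambda>y k. y * (y + 1)) = ?h2 + 2 * ?h" .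
  show ?thesis
  proof -
    have "(M - 1) * (e * (h2 + h)) = e * ((M - 1) * (h2 + 2 * h) - g)" if "g = (M - 1) * h" for M e h2 h g :: real
      unfolding that by (simp add: algebra_simps)
    from this[OF gh] show ?thesis unfolding second_mom_def 1 2 .
  qed
qed

lemma third_mom_marked_step:
  assumes fin: "finite (set_pmf a)" and m: "m \<ge> 2" and crit: "critical_law m a"
  shows "third_mom m (marked_step m r a) \<le> tmom a m (\<lambda>y k. 1) ^ (m - 1) * third_mom m a"
proof -
  let ?g = "tmom a m (\<lambda>y k. 1)" and ?h = "tmom a m (\<lambda>y k. y)"
  and ?h2 = "tmom a m (\<lambda>y k. y * (y - 1))" and ?h3 = "tmom a m (\<lambda>y k. y * (y - 1) * (y - 2))"
  have g: "?g > 0" using tmom_one_ge_1[OF fin, of m] m by simp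
  have gh: "?g = (real m - 1) * ?h" using crit fin by (simp add: critical_law_iff)
  then have hg: "?h / ?g = 1 / (real m - 1)" using g m by (auto simp: field_simps)
  have "tmom (marked_step m r a) m (\<lambda>y k. (y - 1) * y * (y + 1)) =
      tmom (iid_sum m a) m (\<lambda>y k. y * (y - 1) * (y - 2)) / m"
    using m by (intro tmom_marked_step) (auto simp: algebra_simps)
  also have "\<dots> = ?g ^ m * (m * (?h3 / ?g) + 3 * real m * (real m - 1) * (?h2 / ?g) * (1 / (real m - 1))
      + m * (real m - 1) * (real m - 2) * (1 / (real m - 1)) ^ 3) / m"
    by (simp only: tmom_iid_sum[OF fin g] hg)
  also have "?g ^ m = ?g ^ (m - 1) * ?g"
    using m by (cases m) auto
  also have "?g ^ (m - 1) * ?g * (m * (?h3 / ?g) + 3 * real m * (real m - 1) * (?h2 / ?g) * (1 / (real m - 1))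
      + m * (real m - 1) * (real m - 2) * (1 / (real m - 1)) ^ 3) / m
    = ?g ^ (m - 1) * (?h3 + 3 * ?h2 + (real m - 2) / (real m - 1)\<^sup>2 * ?g)"
  proof -
    have "g * (M * (h3 / g) + 3 * M * (M - 1) * (h2 / g) * (1 / (M - 1))
      + M * (M - 1) * (M - 2) * (1 / (M - 1)) ^ 3) / M = h3 + 3 * h2 + (M - 2) / (M - 1)\<^sup>2 * g"
      if "g > 0" "M > 1" for g M h2 h3 :: real
    proof -
      have "(M - 1) * (1 / (M - 1)) ^ 3 = 1 / (M - 1)\<^sup>2"
        using that by (simp add: power3_eq_cube power2_eq_square)
      then have "M * (M - 1) * (M - 2) * (1 / (M - 1)) ^ 3 = M * (M - 2) * (1 / (M - 1)\<^sup>2)"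
        by (metis (no_types, opaque_lifting) mult.assoc mult.commute)
      then show ?thesis using that by (simp add: distrib_left add_divide_distrib)
    qed
    from arg_cong[OF this[OF g, of "real m" ?h3 ?h2], of "\<lambda>x. ?g ^ (m - 1) * x"] m
    show ?thesis by (simp only: mult.assoc times_divide_eq_right)
  qed
  finally have 1: "tmom (marked_step m r a) m (\<lambda>y k. (y - 1) * y * (y + 1)) =
    ?g ^ (m - 1) * (?h3 + 3 * ?h2 + (real m - 2) / (real m - 1)\<^sup>2 * ?g)" .
  have "tmom a m (\<lambda>y k. (y - 1) * y * (y + 1)) =
      tmom a m (\<lambda>y k. y * (y - 1) * (y - 2) + 3 * (y * (y - 1)))"
    by (simp add: algebra_simps)
  also have "\<dots> = ?h3 + 3 * ?h2" by (simp only: tmom_add[OF fin] tmom_cmult)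
  finally have 2: "tmom a m (\<lambda>y k. (y - 1) * y * (y + 1)) = ?h3 + 3 * ?h2" .
  have "(real m - 2) / (real m - 1)\<^sup>2 \<le> 1"
  proof -
    have "real m - 1 \<le> (real m - 1)\<^sup>2" using m by (intro self_le_power) auto
    then show ?thesis using m by (simp add: field_simps)
  qed
  then have "(real m - 2) / (real m - 1)\<^sup>2 * ?g \<le> ?g"
    using mult_right_mono[of "(real m - 2) / (real m - 1)\<^sup>2" 1 ?g] g by linarith
  then have "?g ^ (m - 1) * (?h3 + 3 * ?h2 + (real m - 2) / (real m - 1)\<^sup>2 * ?g)
      \<le> ?g ^ (m - 1) * (?h3 + 3 * ?h2 + ?g)"
    using g by (intro mult_left_mono) auto
  then show ?thesis
    unfolding third_mom_def second_mom_marked_step[OF assms] 1 2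
    by (simp add: algebra_simps)
qed

section \<open>Transport of capped marks\<close>

lemma snd_iid_sum_le:
  assumes "\<And>y k. (y, k) \<in> set_pmf a \<Longrightarrow> k \<le> r"
  shows "(y, k) \<in> set_pmf (iid_sum n a) \<Longrightarrow> k \<le> n * r"
proof (induction n arbitrary: y k)
  case (Suc n)
  then show ?case using assms by (fastforce simp: add_pmf_def intro: add_mono)
qed simp

lemma snd_marked_step_le: "(y, k) \<in> set_pmf (marked_step m r a) \<Longrightarrow> k \<le> r"
  by (auto simp: marked_step_def split: if_splits)

text \<open>The factor \<open>y + 1\<close> becomes \<open>S\<close> after the shift; it vanishes
  exactly where marks are dropped, so dropping them costs nothing.\<close>

definition mark_mass :: "nat \<Rightarrow> (nat \<times> nat) pmf \<Rightarrow> real" where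
  "mark_mass m a = tmom a m (\<lambda>y k. (y + 1) * k)"

definition full_mass :: "nat \<Rightarrow> nat \<Rightarrow> (nat \<times> nat) pmf \<Rightarrow> real" where
  "full_mass m r a = tmom a m (\<lambda>y k. (y + 1) * of_bool (k = real r))"

text \<open>Without the cap the mass would be multiplied by exactly \<open>E(m^Y)^(m - 1)\<close>. A
  sum of \<open>m\<close> marks is at most \<open>m r\<close>, so capping removes at most
  \<open>(m - 1) r\<close>, and only where the new mark equals \<open>r\<close>.\<close>

lemma mark_mass_marked_step:
  assumes fin: "finite (set_pmf a)" and m: "m \<ge> 2" and crit: "critical_law m a" and r: "r \<ge> 1"
    and le: "\<And>y k. (y, k) \<in> set_pmf a \<Longrightarrow> k \<le> r"
  shows "mark_mass m (marked_step m r a) \<ge> tmom a m (\<lambda>y k. 1) ^ (m - 1) * mark_mass m a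
     - (real m - 1) * r * full_mass m r (marked_step m r a)"
proof -
  let ?g = "tmom a m (\<lambda>y k. 1)" and ?h = "tmom a m (\<lambda>y k. y)"
  and ?c = "tmom a m (\<lambda>y k. k)" and ?d = "tmom a m (\<lambda>y k. y * k)"
  have g: "?g > 0" using tmom_one_ge_1[OF fin, of m] m by simp
  have gh: "?g = (real m - 1) * ?h" using crit fin by (simp add: critical_law_iff)
  then have hg: "?h / ?g = 1 / (real m - 1)" using g m by (auto simp: field_simps)
  note finm = finite_set_iid_sum[OF fin, of m]
  have 1: "mark_mass m (marked_step m r a) = tmom (iid_sum m a) m (\<lambda>y k. y * min k r) / m"
    unfolding mark_mass_def using m by (intro tmom_marked_step) (auto simp: algebra_simps)
  \<comment> \<open>At \<open>S = 0\<close> the new mark is \<open>0\<close>, which differs from the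
    cap because \<open>r \<ge> 1\<close>.\<close>
  have 2: "full_mass m r (marked_step m r a) = tmom (iid_sum m a) m (\<lambda>y k. y * of_bool (k \<ge> r)) / m"
    unfolding full_mass_def using m r by (intro tmom_marked_step) (auto simp: algebra_simps)
  have "tmom (iid_sum m a) m (\<lambda>y k. y * k) =
      ?g ^ m * (m * (?d / ?g) + m * (real m - 1) * (?c / ?g) * (1 / (real m - 1)))"
    by (simp only: tmom_iid_sum[OF fin g] hg)
  also have "?g ^ m = ?g ^ (m - 1) * ?g"
    using m by (cases m) auto
  also have "?g ^ (m - 1) * ?g * (m * (?d / ?g) + m * (real m - 1) * (?c / ?g) * (1 / (real m - 1))) =
      m * (?g ^ (m - 1) * (?d + ?c))"
    using m g by (simp add: distrib_left)
  finally have "tmom (iid_sum m a) m (\<lambda>y k. y * k) = m * (?g ^ (m - 1) * (?d + ?c))" .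
  moreover have "mark_mass m a = ?d + ?c"
  proof -
    have "(\<lambda>y k :: real. (y + 1) * k) = (\<lambda>y k. y * k + k)"
      by (simp add: fun_eq_iff distrib_right)
    then show ?thesis unfolding mark_mass_def by (simp only: tmom_add[OF fin])
  qed
  ultimately have 3: "tmom (iid_sum m a) m (\<lambda>y k. y * k) = m * (?g ^ (m - 1) * mark_mass m a)"
    by simp
  have "tmom (iid_sum m a) m (\<lambda>y k. y * k) \<le>
    tmom (iid_sum m a) m (\<lambda>y k. y * min k r + ((real m - 1) * r) * (y * of_bool (k \<ge> r)))"
  proof (rule tmom_mono[OF finm])
    fix y k assume "(y, k) \<in> set_pmf (iid_sum m a)"
    then have "k \<le> m * r" using snd_iid_sum_le le by blast
    then have k: "real k \<le> real m * real r" by (metis of_nat_le_iff of_nat_mult)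
    have "real k \<le> min (real k) r + (real m - 1) * r * of_bool (real k \<ge> r)"
      using k by (auto simp: algebra_simps)
    then have "real y * real k \<le> real y * (min (real k) r + (real m - 1) * r * of_bool (real k \<ge> r))"
      by (intro mult_left_mono) auto
    then show "real y * real k \<le> real y * min (real k) r + (real m - 1) * r * (real y * of_bool (real k \<ge> r))"
      by (simp add: algebra_simps)
  qed simp
  also have "\<dots> = m * mark_mass m (marked_step m r a)
      + (real m - 1) * r * (m * full_mass m r (marked_step m r a))"
    unfolding 1 2 using m by (simp add: tmom_add[OF finm] tmom_cmult)
  finally have "m * (?g ^ (m - 1) * mark_mass m a) \<le> m * (mark_mass m (marked_step m r a)
      + (real m - 1) * r * full_mass m r (marked_step m r a))"
    unfolding 3 by (simp add: algebra_simps)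
  then show ?thesis using m by simp
qed

section \<open>Critical chains\<close>

locale critical_chain =
  fixes m r :: nat and a0 :: "(nat \<times> nat) pmf"
  assumes m2: "m \<ge> 2" and r1: "r \<ge> 1"
    and fin0: "finite (set_pmf a0)"
    and crit0: "critical_law m a0"
    and marks0: "\<And>y k. (y, k) \<in> set_pmf a0 \<Longrightarrow> k \<le> r"
begin

definition chain :: "nat \<Rightarrow> (nat \<times> nat) pmf" where
  "chain n = (marked_step m r ^^ n) a0"

definition G :: "nat \<Rightarrow> real" where "G n = tmom (chain n) m (\<lambda>y k. 1)"
definition P :: "nat \<Rightarrow> real" where "P n = (\<Prod>i<n. G i ^ (m - 1))"
definition A :: "nat \<Rightarrow> real" where "A n = second_mom m (chain n)"
definition Lam :: real where "Lam = tmom a0 m (\<lambda>y k. y ^ 3)"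
text \<open>Product of the factor \<open>2 (m - 1)^2\<close> from the Cauchy-Schwarz inequality and
  the bound \<open>2 (m - 1) Lam\<close> on the initial third moment.\<close>

definition Kap :: real where "Kap = 4 * (real m - 1) ^ 3 * Lam"

lemma chain_0 [simp]: "chain 0 = a0"
  by (simp add: chain_def)

lemma chain_Suc: "chain (Suc n) = marked_step m r (chain n)"
  by (simp add: chain_def)

lemma fin: "finite (set_pmf (chain n))"
  by (induction n) (simp_all add: fin0 chain_Suc finite_set_marked_step)

lemma crit: "critical_law m (chain n)"
  by (induction n) (simp_all add: crit0 chain_Suc critical_law_marked_step fin m2)

lemma marks_le: "(y, k) \<in> set_pmf (chain n) \<Longrightarrow> k \<le> r"
  by (cases n) (auto simp: chain_Suc dest: marks0 snd_marked_step_le)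

lemma G_eq: "G n = (real m - 1) * tmom (chain n) m (\<lambda>y k. y)"
  using crit[of n] fin[of n] by (simp add: critical_law_iff G_def)

lemma G_ge_1: "G n \<ge> 1"
  unfolding G_def using m2 by (intro tmom_one_ge_1 fin) auto

text \<open>Split at \<open>y = 2\<close>: below, \<open>s^y \<le> s^2\<close>; above,
  \<open>y / 2 \<ge> 1\<close>. The factor \<open>1 / 2\<close> lets the mean be absorbed later,
  giving bounds that do not depend on the law.\<close>

lemma tmom_one_le:
  assumes "s \<ge> 1"
  shows "tmom (chain n) s (\<lambda>y k. 1) \<le> s\<^sup>2 + tmom (chain n) s (\<lambda>y k. y) / 2"
proof -
  have "s ^ y \<le> s\<^sup>2 + real y * s ^ y / 2" for y
  proof (cases "y \<le> 2")
    case True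
    then have "s ^ y \<le> s\<^sup>2" using assms by (intro power_increasing) auto
    moreover have "real y * s ^ y / 2 \<ge> 0" using assms by simp
    ultimately show ?thesis by linarith
  next
    case False
    then have "2 * s ^ y \<le> real y * s ^ y" using assms by (intro mult_right_mono) auto
    moreover have "s\<^sup>2 \<ge> 0" by simp
    ultimately show ?thesis by linarith
  qed
  then have "expec (chain n) (\<lambda>u. s ^ fst u) \<le>
      expec (chain n) (\<lambda>u. s\<^sup>2 + real (fst u) * s ^ fst u / 2)"
    by (intro expec_mono_finite fin) auto
  also have "\<dots> = s\<^sup>2 + expec (chain n) (\<lambda>u. real (fst u) * s ^ fst u) / 2"
    by (simp add: integrable_finite_pmf fin)
  finally show ?thesis by (simp add: tmom_def)
qed

lemma mean_nonneg: "s \<ge> 0 \<Longrightarrow> tmom (chain n) s (\<lambda>y k. y) \<ge> 0"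
  unfolding tmom_def by (intro integral_nonneg_AE) auto

lemma G_le: "G n \<le> 2 * (real m)\<^sup>2"
proof -
  have h: "tmom (chain n) m (\<lambda>y k. y) \<ge> 0"
    by (intro mean_nonneg) auto
  have "1 * tmom (chain n) m (\<lambda>y k. y) \<le> G n"
    unfolding G_eq using m2 by (intro mult_right_mono[OF _ h]) auto
  then show ?thesis
    using tmom_one_le[of "real m" n] m2 unfolding G_def by simp
qed

lemma P_0 [simp]: "P 0 = 1"
  by (simp add: P_def)

lemma P_Suc: "P (Suc n) = P n * G n ^ (m - 1)"
  by (simp add: P_def)

lemma P_ge_1: "P n \<ge> 1"
  unfolding P_def using G_ge_1 by (intro prod_ge_1) (auto intro: one_le_power)

lemma P_pos: "P n > 0"
  using P_ge_1[of n] by linarith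

lemma P_Suc_ge: "P n \<le> P (Suc n)"
  unfolding P_Suc using P_ge_1[of n] one_le_power[OF G_ge_1[of n], of "m - 1"]
  by (simp add: mult_le_cancel_left1)

lemma P_mono: "i \<le> j \<Longrightarrow> P i \<le> P j"
  using P_Suc_ge by (rule lift_Suc_mono_le)

section \<open>Quadratic growth of \<open>P\<close>\<close>

lemma A_Suc: "A (Suc n) = G n ^ (m - 1) * (A n - G n)"
  unfolding A_def chain_Suc G_def by (intro second_mom_marked_step fin m2 crit)

lemma A_nonneg: "A n \<ge> 0"
  unfolding A_def second_mom_def tmom_def using m2
  by (intro mult_nonneg_nonneg integral_nonneg_AE) auto

text \<open>The next second moment is non-negative and is a positive multiple of
  \<open>A n - G n\<close>.\<close>

lemma A_ge_G: "A n \<ge> G n"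
proof -
  have "0 \<le> G n ^ (m - 1) * (A n - G n)" using A_nonneg[of "Suc n"] by (simp add: A_Suc)
  moreover have "G n ^ (m - 1) > 0" using G_ge_1[of n] by (intro zero_less_power) linarith
  ultimately show ?thesis by (simp add: zero_le_mult_iff)
qed

lemma third_mom_le: "third_mom m (chain n) \<le> P n * third_mom m a0"
proof (induction n)
  case (Suc n)
  have "third_mom m (chain (Suc n)) \<le> G n ^ (m - 1) * third_mom m (chain n)"
    unfolding chain_Suc G_def by (intro third_mom_marked_step fin m2 crit)
  also have "\<dots> \<le> G n ^ (m - 1) * (P n * third_mom m a0)"
    using G_ge_1[of n] by (intro mult_left_mono Suc.IH zero_le_power) linarith
  finally show ?case by (simp add: P_Suc mult_ac)
qed simp

lemma third_mom_0_le: "third_mom m a0 \<le> 2 * (real m - 1) * Lam"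
proof -
  have "third_mom m a0 = tmom a0 m (\<lambda>y k. (y - 1) * y * (y + 1) + (real m - 1) * (y * (y + 1)))"
    unfolding third_mom_def second_mom_def by (simp only: tmom_add[OF fin0] tmom_cmult)
  also have "\<dots> \<le> tmom a0 m (\<lambda>y k. 2 * (real m - 1) * y ^ 3)"
  proof (rule tmom_mono[OF fin0])
    fix n k :: nat
    let ?y = "real n"
    show "(?y - 1) * ?y * (?y + 1) + (real m - 1) * (?y * (?y + 1)) \<le> 2 * (real m - 1) * ?y ^ 3"
    proof (cases n)
      case (Suc l)
      define z where "z = real l"
      have z: "z \<ge> 0" "?y = z + 1" by (auto simp: z_def Suc)
      define M where "M = real m - 2"
      have M: "M \<ge> 0" "real m - 1 = M + 1" using m2 by (auto simp: M_def)
      show ?thesis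
        unfolding z(2) M(2) using z(1) M(1)
        by (simp add: algebra_simps power3_eq_cube add_increasing2)
    qed simp
  qed simp
  also have "\<dots> = 2 * (real m - 1) * Lam" by (simp only: tmom_cmult Lam_def)
  finally show ?thesis .
qed

text \<open>Cauchy-Schwarz for the weight \<open>(y + 1) m^y\<close>, applied to the functions
  \<open>1\<close> and \<open>y\<close>. The moment of \<open>y^2\<close> is at most
  \<open>third_mom\<close> because \<open>m - 1 \<ge> 1\<close>.\<close>

lemma A_sq_le_third: "(A n)\<^sup>2 \<le> 2 * (real m - 1)\<^sup>2 * G n * third_mom m (chain n)"
proof -
  let ?a = "chain n"
  define x1 where "x1 = tmom ?a m (\<lambda>y k. y + 1)"
  define x2 where "x2 = tmom ?a m (\<lambda>y k. y * (y + 1))"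
  define x3 where "x3 = tmom ?a m (\<lambda>y k. y\<^sup>2 * (y + 1))"
  have x1_eq: "x1 = tmom ?a m (\<lambda>y k. y) + G n"
    unfolding x1_def G_def by (rule tmom_add[OF fin])
  have h: "tmom ?a m (\<lambda>y k. y) \<ge> 0" by (intro mean_nonneg) auto
  have hG: "tmom ?a m (\<lambda>y k. y) \<le> G n"
    unfolding G_eq using m2 h by (simp add: mult_le_cancel_right1)
  have x1: "x1 > 0" "x1 \<le> 2 * G n" using x1_eq h hG G_ge_1[of n] by linarith+
  have x2: "x2 \<ge> 0" and x3: "x3 \<ge> 0"
    unfolding x2_def x3_def tmom_def by (intro integral_nonneg_AE; simp)+
  \<comment> \<open>The minimiser of the quadratic \<open>x3 - 2 t x2 + t^2 x1\<close>, whose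
    non-negativity is the Cauchy-Schwarz inequality.\<close>
  define t where "t = x2 / x1"
  have "0 \<le> tmom ?a m (\<lambda>y k. (y - t)\<^sup>2 * (y + 1))"
    unfolding tmom_def by (intro integral_nonneg_AE) auto
  also have "(\<lambda>y k::real. (y - t)\<^sup>2 * (y + 1)) =
      (\<lambda>y k. y\<^sup>2 * (y + 1) - (2 * t) * (y * (y + 1)) + t\<^sup>2 * (y + 1))"
    by (simp add: fun_eq_iff power2_eq_square algebra_simps)
  also have "tmom ?a m \<dots> = x3 - 2 * t * x2 + t\<^sup>2 * x1"
    unfolding x1_def x2_def x3_def by (simp only: tmom_add[OF fin] tmom_diff[OF fin] tmom_cmult)
  also have "\<dots> = x3 - x2\<^sup>2 / x1"
    using x1 by (simp add: t_def power2_eq_square field_simps)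
  finally have cs: "x2\<^sup>2 \<le> x3 * x1" using x1 by (simp add: field_simps)
  have "(\<lambda>y k :: real. (y - 1) * y * (y + 1)) = (\<lambda>y k. y\<^sup>2 * (y + 1) - y * (y + 1 :: real))"
    by (simp add: fun_eq_iff power2_eq_square algebra_simps)
  then have "third_mom m ?a = x3 - x2 + (real m - 1) * x2"
    unfolding third_mom_def second_mom_def x2_def x3_def by (simp only: tmom_diff[OF fin])
  moreover have "1 * x2 \<le> (real m - 1) * x2" using m2 x2 by (intro mult_right_mono) auto
  ultimately have le: "x3 \<le> third_mom m ?a" by simp
  have "x3 * x1 \<le> third_mom m ?a * (2 * G n)"
    using le x1 x3 by (intro mult_mono) auto
  with cs have "x2\<^sup>2 \<le> 2 * G n * third_mom m ?a" by (simp add: mult_ac)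
  then have "(real m - 1)\<^sup>2 * x2\<^sup>2 \<le> (real m - 1)\<^sup>2 * (2 * G n * third_mom m ?a)"
    by (intro mult_left_mono) auto
  then show ?thesis
    by (simp add: A_def second_mom_def x2_def power_mult_distrib mult_ac)
qed

lemma A_sq_le: "(A n)\<^sup>2 \<le> Kap * G n * P n"
proof -
  have "third_mom m (chain n) \<le> P n * (2 * (real m - 1) * Lam)"
    using third_mom_le[of n] mult_left_mono[OF third_mom_0_le, of "P n"] P_pos[of n] by linarith
  then have "2 * (real m - 1)\<^sup>2 * G n * third_mom m (chain n) \<le>
      2 * (real m - 1)\<^sup>2 * G n * (P n * (2 * (real m - 1) * Lam))"
    using G_ge_1[of n] by (intro mult_left_mono) auto
  also have "\<dots> = Kap * G n * P n"
    by (simp add: Kap_def power2_eq_square power3_eq_cube)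
  finally show ?thesis using A_sq_le_third[of n] by linarith
qed

lemma Kap_pos: "Kap > 0"
proof -
  have "A 0 \<ge> 1" using A_ge_G[of 0] G_ge_1[of 0] by linarith
  then have "(A 0)\<^sup>2 > 0" by simp
  then have "Kap * G 0 > 0" using A_sq_le[of 0] unfolding P_0 by linarith
  then show ?thesis using G_ge_1[of 0] by (simp add: zero_less_mult_iff)
qed

lemma Lam_pos: "Lam > 0"
  using Kap_pos m2 by (simp add: Kap_def zero_less_mult_iff)

text \<open>\<open>P\<close> grows by the same factor \<open>G n ^ (m - 1)\<close>, so normalisation
  leaves a telescoping difference.\<close>

lemma A_div_P_Suc: "A (Suc n) / P (Suc n) = A n / P n - G n / P n"
proof -
  have "G n > 0" using G_ge_1[of n] by linarith
  then show ?thesis unfolding A_Suc P_Suc using P_pos[of n]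
    by (simp add: diff_divide_distrib mult.commute)
qed

text \<open>The sequence \<open>u n = A n / P n\<close> satisfies \<open>u (n + 1) \<le> u n - (u n)\<^sup>2 / Kap\<close>.\<close>

lemma A_div_P_le: "A n / P n \<le> Kap / (real n + 1)"
proof (induction n)
  case 0
  have "A 0 * A 0 \<le> Kap * A 0"
  proof -
    have "A 0 * A 0 \<le> Kap * G 0" using A_sq_le[of 0] by (simp add: power2_eq_square)
    also have "\<dots> \<le> Kap * A 0" using A_ge_G[of 0] Kap_pos by (intro mult_left_mono) auto
    finally show ?thesis .
  qed
  moreover have "A 0 > 0" using A_ge_G[of 0] G_ge_1[of 0] by linarith
  ultimately show ?case by simp
next
  case (Suc n)
  define u where "u = A n / P n / Kap"
  have u: "u \<ge> 0" using A_nonneg[of n] P_pos[of n] Kap_pos by (simp add: u_def)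
  have un: "u \<le> 1 / (real n + 1)"
    using divide_right_mono[OF Suc.IH, of Kap] Kap_pos by (simp add: u_def)
  have "(A n)\<^sup>2 / (P n * P n * Kap) \<le> Kap * G n * P n / (P n * P n * Kap)"
    using A_sq_le[of n] P_pos[of n] Kap_pos by (intro divide_right_mono) auto
  then have "Kap * u\<^sup>2 \<le> G n / P n"
    using P_pos[of n] Kap_pos by (simp add: u_def power2_eq_square field_simps)
  then have 1: "A (Suc n) / P (Suc n) \<le> Kap * (u - u\<^sup>2)"
    using Kap_pos unfolding A_div_P_Suc by (simp add: u_def right_diff_distrib)
  \<comment> \<open>The map \<open>u / (1 + u)\<close> is increasing and sends
    \<open>1 / (n + 1)\<close> to \<open>1 / (n + 2)\<close>, which closes the induction.\<close>
  have "u - u\<^sup>2 \<le> u / (1 + u)"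
    using u by (simp add: field_simps power2_eq_square)
  also have "\<dots> \<le> 1 / (real n + 2)"
    using u un by (simp add: field_simps)
  finally have "Kap * (u - u\<^sup>2) \<le> Kap * (1 / (real n + 2))"
    using Kap_pos by (intro mult_left_mono) auto
  with 1 show ?case by (simp add: add.commute)
qed

text \<open>Between \<open>n\<close> and \<open>2 n\<close> the sequence \<open>A / P\<close> loses
  at least \<open>n / P (2 n)\<close>, but it starts from at most \<open>Kap / (n + 1)\<close> and
  stays non-negative.\<close>

lemma P_quadratic: "(real n)\<^sup>2 \<le> Kap * P (2 * n)"
proof -
  have "A n / P n = A (n + k) / P (n + k) + (\<Sum>i<k. G (n + i) / P (n + i))" for k
    using A_div_P_Suc by (induction k) auto
  from this[of n] have "(\<Sum>i<n. G (n + i) / P (n + i)) \<le> A n / P n"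
    using A_nonneg[of "n + n"] P_pos[of "n + n"] by (simp add: divide_nonneg_pos)
  moreover have "(\<Sum>i<n. 1 / P (2 * n)) \<le> (\<Sum>i<n. G (n + i) / P (n + i))"
    using G_ge_1 P_mono P_pos order_trans[OF zero_le_one G_ge_1] by (intro sum_mono frac_le) auto
  ultimately have "real n / P (2 * n) \<le> Kap / (real n + 1)"
    using A_div_P_le[of n] by simp
  then have "real n * (real n + 1) \<le> Kap * P (2 * n)"
    using P_pos[of "2 * n"] by (simp add: field_simps)
  then show ?thesis by (simp add: power2_eq_square algebra_simps)
qed

section \<open>Upper and lower bounds for the mark mass along the chain\<close>

lemma mark_mass_chain_le: "mark_mass m (chain n) \<le> 4 * (real m)\<^sup>2 * r"
proof -
  have "mark_mass m (chain n) \<le> tmom (chain n) m (\<lambda>y k. r * (y + 1))"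
    unfolding mark_mass_def by (intro tmom_mono fin) (auto dest: marks_le simp: mult.commute intro!: mult_mono)
  also have "\<dots> = r * (tmom (chain n) m (\<lambda>y k. y) + G n)"
    by (simp only: tmom_cmult tmom_add[OF fin] G_def)
  also have "\<dots> \<le> r * (4 * (real m)\<^sup>2)"
  proof (rule mult_left_mono)
    have "tmom (chain n) m (\<lambda>y k. y) \<le> G n"
      unfolding G_eq using m2 mean_nonneg[of m n] by (simp add: mult_le_cancel_right1)
    then show "tmom (chain n) m (\<lambda>y k. y) + G n \<le> 4 * (real m)\<^sup>2" using G_le[of n] by simp
  qed simp
  finally show ?thesis by (simp add: mult_ac)
qed

text \<open>Since \<open>P \<ge> 1\<close>, the capping error of each step may be charged with the
  factor \<open>P (Suc n)\<close>. All errors then collect inside the bracket.\<close>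

lemma mark_mass_chain_ge:
  assumes "\<And>k. 1 \<le> k \<Longrightarrow> k \<le> n \<Longrightarrow> full_mass m r (chain k) \<le> q" and "q \<ge> 0"
  shows "P n * (mark_mass m a0 - (real m - 1) * r * n * q) \<le> mark_mass m (chain n)"
  using assms(1)
proof (induction n)
  case (Suc n)
  let ?c = "(real m - 1) * r"
  have c: "?c * q \<ge> 0" using m2 assms(2) by simp
  have "P (Suc n) * (mark_mass m a0 - ?c * Suc n * q) =
      G n ^ (m - 1) * (P n * (mark_mass m a0 - ?c * n * q)) - P (Suc n) * (?c * q)"
    by (simp add: P_Suc algebra_simps)
  also have "\<dots> \<le> G n ^ (m - 1) * mark_mass m (chain n) - 1 * (?c * q)"
    using G_ge_1[of n] P_ge_1[of "Suc n"] c Suc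
    by (intro diff_mono mult_left_mono mult_right_mono Suc.IH zero_le_power) auto
  also have "\<dots> \<le> G n ^ (m - 1) * mark_mass m (chain n) - ?c * full_mass m r (chain (Suc n))"
    using Suc.prems[of "Suc n"] m2 by (auto intro!: mult_left_mono)
  also have "\<dots> \<le> mark_mass m (chain (Suc n))"
    unfolding chain_Suc G_def by (intro mark_mass_marked_step fin m2 crit r1 marks_le)
  finally show ?case .
qed simp

end

section \<open>Exponential moments above the critical weight\<close>

context critical_chain
begin

context
  fixes \<epsilon> :: real
  assumes eps: "0 < \<epsilon>" "\<epsilon> \<le> 1 / 2"
begin

definition s\<^sub>\<epsilon> :: real where "s\<^sub>\<epsilon> = real m * (1 + \<epsilon>)"

definition Psi :: "nat \<Rightarrow> real" where "Psi n = psi_mom (chain n) s\<^sub>\<epsilon>"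

lemma s_ge: "s\<^sub>\<epsilon> \<ge> real m"
  using eps m2 by (simp add: s\<^sub>\<epsilon>_def)

lemma s_ge_1: "s\<^sub>\<epsilon> \<ge> 1"
  using s_ge m2 by simp

text \<open>For \<open>y \<ge> 1\<close> the integrand increases in \<open>s \<ge> m\<close>, for
  \<open>y = 0\<close> it is constant, and at \<open>s = m\<close> its expectation vanishes by
  criticality.\<close>

lemma Psi_nonneg: "Psi n \<ge> 0"
proof -
  have "psi_mom (chain n) m \<le> psi_mom (chain n) s\<^sub>\<epsilon>"
    unfolding psi_mom_def tmom_def
  proof (rule expec_mono_finite[OF fin])
    fix u :: "nat \<times> nat"
    obtain y k where u: "u = (y, k)" by (cases u)
    show "((real m - 1) * real (fst u) - 1) * real m ^ fst u \<le> ((s\<^sub>\<epsilon> - 1) * real (fst u) - 1) * s\<^sub>\<epsilon> ^ fst u"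
    proof (cases "y = 0")
      case False
      then have "1 * 1 \<le> (real m - 1) * real y" using m2 by (intro mult_mono) auto
      moreover have "(real m - 1) * real y \<le> (s\<^sub>\<epsilon> - 1) * real y"
        using s_ge by (intro mult_right_mono) auto
      ultimately show ?thesis unfolding u fst_conv using s_ge by (intro mult_mono power_mono) auto
    qed (simp add: u)
  qed
  then show ?thesis using crit[of n] by (simp add: Psi_def critical_law_def)
qed

definition Gs :: "nat \<Rightarrow> real" where "Gs n = tmom (chain n) s\<^sub>\<epsilon> (\<lambda>y k. 1)"

lemma Gs_ge_1: "Gs n \<ge> 1"
  unfolding Gs_def by (intro tmom_one_ge_1 fin s_ge_1)

lemma G_le_Gs: "G n \<le> Gs n"
  unfolding G_def Gs_def tmom_def using s_ge m2
  by (intro expec_mono_finite fin) (auto intro!: power_mono)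

text \<open>Log-convexity of \<open>t \<mapsto> E(e\<^sup>t\<^sup>Y)\<close>, in the form of its tangent line at \<open>s\<^sub>\<epsilon>\<close>.\<close>

lemma Gs_power_le: "Gs n ^ (m - 1) \<le> G n ^ (m - 1) * ((1 + \<epsilon>) * exp (\<epsilon> * Psi n))"
proof -
  define l where "l = ln (1 + \<epsilon>)"
  have l: "l \<ge> 0" "l \<le> \<epsilon>" "exp l = 1 + \<epsilon>"
    using eps ln_add_one_self_le_self[of \<epsilon>] by (auto simp: l_def)
  define h where "h = tmom (chain n) s\<^sub>\<epsilon> (\<lambda>y k. y)"
  \<comment> \<open>The mean of \<open>Y\<close> under the law tilted by
    \<open>s\<^sub>\<epsilon> ^ Y\<close>. Centring the tangent line there makes its linear term
    vanish in expectation.\<close>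
  define \<mu> where "\<mu> = h / Gs n"
  have g: "Gs n > 0" using Gs_ge_1[of n] by linarith
  have "exp (- l * \<mu>) * (Gs n - l * (h - \<mu> * Gs n)) =
      tmom (chain n) s\<^sub>\<epsilon> (\<lambda>y k. exp (- l * \<mu>) * (1 - l * (y - \<mu> * 1)))"
    unfolding Gs_def h_def by (simp only: tmom_cmult tmom_diff[OF fin])
  also have "\<dots> \<le> G n"
    unfolding G_def tmom_def
  proof (rule expec_mono_finite[OF fin])
    fix u :: "nat \<times> nat"
    define y where "y = fst u"
    have sp: "s\<^sub>\<epsilon> ^ y = real m ^ y * exp (l * y)"
      using l(3) by (simp add: s\<^sub>\<epsilon>_def power_mult_distrib mult.commute[of l] exp_of_nat_mult)
    have "1 - l * (real y - \<mu>) \<le> exp (- (l * (real y - \<mu>)))"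
      using exp_ge_add_one_self[of "- (l * (real y - \<mu>))"] by simp
    then have "exp (- l * \<mu>) * (1 - l * (real y - \<mu>)) * s\<^sub>\<epsilon> ^ y \<le>
        exp (- l * \<mu>) * exp (- (l * (real y - \<mu>))) * s\<^sub>\<epsilon> ^ y"
      using s_ge_1 by (intro mult_right_mono mult_left_mono) auto
    also have "\<dots> = real m ^ y * (exp (- l * \<mu>) * exp (- (l * (real y - \<mu>))) * exp (l * y))"
      unfolding sp by simp
    also have "exp (- l * \<mu>) * exp (- (l * (real y - \<mu>))) * exp (l * y) = 1"
      by (simp add: algebra_simps flip: exp_add)
    finally show "exp (- l * \<mu>) * (1 - l * (real (fst u) - \<mu> * 1)) * s\<^sub>\<epsilon> ^ fst u \<le> 1 * real m ^ fst u"
      by (simp add: y_def)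
  qed
  also have "h - \<mu> * Gs n = 0" using g by (simp add: \<mu>_def)
  finally have "exp (- l * \<mu>) * Gs n \<le> G n" by simp
  then have "exp (l * \<mu>) * (exp (- l * \<mu>) * Gs n) \<le> exp (l * \<mu>) * G n"
    by (intro mult_left_mono) auto
  moreover have "exp (l * \<mu>) * (exp (- l * \<mu>) * Gs n) = Gs n"
    by (simp add: exp_minus)
  ultimately have 1: "Gs n \<le> exp (l * \<mu>) * G n" by linarith
  \<comment> \<open>\<open>Psi\<close> measures by how much the tilted mean exceeds
    \<open>1 / (s - 1)\<close>, so it controls \<open>\<mu>\<close>.\<close>
  have "Psi n = (s\<^sub>\<epsilon> - 1) * h - Gs n"
    unfolding Psi_def h_def Gs_def by (rule psi_mom_eq[OF fin])
  then have "(s\<^sub>\<epsilon> - 1) * \<mu> = 1 + Psi n / Gs n"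
    using g by (simp add: \<mu>_def field_simps)
  also have "\<dots> \<le> 1 + Psi n"
    using Gs_ge_1[of n] Psi_nonneg[of n] by (simp add: divide_le_eq mult_le_cancel_left1)
  finally have "(s\<^sub>\<epsilon> - 1) * \<mu> \<le> 1 + Psi n" .
  moreover have "(real m - 1) * \<mu> \<le> (s\<^sub>\<epsilon> - 1) * \<mu>"
    using s_ge g mean_nonneg[of "s\<^sub>\<epsilon>" n] s_ge_1 by (intro mult_right_mono) (auto simp: \<mu>_def h_def)
  ultimately have mu: "(real m - 1) * \<mu> \<le> 1 + Psi n" by linarith
  have "Gs n ^ (m - 1) \<le> (exp (l * \<mu>) * G n) ^ (m - 1)"
    using 1 g by (intro power_mono) auto
  also have "\<dots> = G n ^ (m - 1) * exp (l * ((real m - 1) * \<mu>))"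
    using m2 by (simp add: power_mult_distrib mult_ac of_nat_diff flip: exp_of_nat_mult)
  also have "\<dots> \<le> G n ^ (m - 1) * exp (l + \<epsilon> * Psi n)"
  proof -
    have "l * ((real m - 1) * \<mu>) \<le> l * (1 + Psi n)"
      using mu l by (intro mult_left_mono) auto
    also have "\<dots> \<le> l + \<epsilon> * Psi n"
      using mult_right_mono[OF l(2) Psi_nonneg[of n]] by (simp add: algebra_simps)
    finally show ?thesis using G_ge_1[of n] by (intro mult_left_mono zero_le_power) auto
  qed
  also have "exp (l + \<epsilon> * Psi n) = (1 + \<epsilon>) * exp (\<epsilon> * Psi n)"
    by (simp add: exp_add l(3))
  finally show ?thesis .
qed

text \<open>The factor \<open>1 + \<epsilon>\<close> of \<open>Gs_power_le\<close> cancels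
  \<open>m / s = 1 / (1 + \<epsilon>)\<close> in the recursion; only
  \<open>exp (\<epsilon> * Psi n)\<close> remains.\<close>

lemma Psi_Suc_le: "Psi (Suc n) \<le> G n ^ (m - 1) * (exp (\<epsilon> * Psi n) * (Psi n - \<epsilon> * G n))"
proof -
  have "Psi (Suc n) = real m / s\<^sub>\<epsilon> * Gs n ^ (m - 1) * (Psi n + (1 - s\<^sub>\<epsilon> / m) * Gs n)"
    unfolding Psi_def chain_Suc Gs_def using m2 by (intro psi_mom_marked_step fin s_ge_1) auto
  also have "1 - s\<^sub>\<epsilon> / m = - \<epsilon>" using m2 by (simp add: s\<^sub>\<epsilon>_def)
  also have "real m / s\<^sub>\<epsilon> = 1 / (1 + \<epsilon>)" using m2 by (simp add: s\<^sub>\<epsilon>_def)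
  finally have eq: "Psi (Suc n) = 1 / (1 + \<epsilon>) * Gs n ^ (m - 1) * (Psi n - \<epsilon> * Gs n)" by simp
  have "1 / (1 + \<epsilon>) * Gs n ^ (m - 1) > 0"
    using eps Gs_ge_1[of n] by (intro mult_pos_pos zero_less_power) auto
  \<comment> \<open>The bracket must be non-negative before the prefactor can be enlarged; its sign
    is read off from \<open>Psi (Suc n) \<ge> 0\<close>.\<close>
  then have br: "Psi n - \<epsilon> * Gs n \<ge> 0"
    using Psi_nonneg[of "Suc n"] mult_pos_neg[of _ "Psi n - \<epsilon> * Gs n"] unfolding eq by (meson not_less)
  have "1 / (1 + \<epsilon>) * Gs n ^ (m - 1) \<le> 1 / (1 + \<epsilon>) * (G n ^ (m - 1) * ((1 + \<epsilon>) * exp (\<epsilon> * Psi n)))"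
    using Gs_power_le[of n] eps by (intro mult_left_mono) auto
  also have "\<dots> = G n ^ (m - 1) * exp (\<epsilon> * Psi n)"
    using eps by simp
  finally have "Psi (Suc n) \<le> G n ^ (m - 1) * exp (\<epsilon> * Psi n) * (Psi n - \<epsilon> * Gs n)"
    unfolding eq using br by (intro mult_right_mono)
  also have "\<dots> \<le> G n ^ (m - 1) * exp (\<epsilon> * Psi n) * (Psi n - \<epsilon> * G n)"
    using G_ge_1[of n] G_le_Gs[of n] eps by (intro mult_left_mono) auto
  finally show ?thesis by (simp add: mult.assoc)
qed

section \<open>Excess of \<open>Psi\<close> over its first-order term\<close>

text \<open>\<open>A n\<close> is the derivative of \<open>Psi n\<close> in
  \<open>\<epsilon>\<close> at \<open>0\<close>, and \<open>\<epsilon> * A n\<close> solves the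
  recursion of \<open>Psi_Suc_le\<close> with the exponential replaced by \<open>1\<close>.
  \<open>Exc\<close> is the excess over it, normalised by the common growth
  \<open>P\<close>.\<close>

definition Exc :: "nat \<Rightarrow> real" where "Exc n = max 0 (Psi n - \<epsilon> * A n) / P n"

lemma Exc_nonneg: "Exc n \<ge> 0"
  using P_pos[of n] by (simp add: Exc_def)

lemma Psi_le_Exc: "Psi n \<le> Exc n * P n + \<epsilon> * A n"
  using P_pos[of n] by (simp add: Exc_def)

text \<open>Two errors remain: a relative one of order \<open>\<epsilon>\<close>, and one of order
  \<open>\<epsilon>^3 (A n)^2\<close>, which \<open>A_sq_le\<close> turns into a multiple of
  \<open>P n\<close>.\<close>

lemma Exc_Suc_le:
  assumes Psi: "Psi n \<le> 2" and A: "\<epsilon> * A n \<le> 1"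
  shows "Exc (Suc n) \<le> (1 + 6 * \<epsilon>) * Exc n + 4 * (real m)\<^sup>2 * \<epsilon> ^ 3 * Kap"
proof -
  define E where "E = max 0 (Psi n - \<epsilon> * A n)"
  define x where "x = exp (\<epsilon> * Psi n)"
  have E: "E \<ge> 0" "Psi n - \<epsilon> * A n \<le> E" by (auto simp: E_def)
  have y: "\<epsilon> * Psi n \<ge> 0" using eps Psi_nonneg[of n] by simp
  have y1: "\<epsilon> * Psi n \<le> 1"
    using mult_mono[of \<epsilon> "1 / 2" "Psi n" 2] eps Psi Psi_nonneg[of n] by simp
  have x1: "x \<ge> 1" using y by (simp add: x_def)
  have "x \<le> 1 + \<epsilon> * Psi n + (\<epsilon> * Psi n)\<^sup>2" unfolding x_def using y y1 by (rule exp_bound)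
  also have "(\<epsilon> * Psi n)\<^sup>2 \<le> \<epsilon> * Psi n"
    using y y1 by (simp add: power2_eq_square mult_left_le_one_le)
  finally have x2: "x - 1 \<le> 2 * \<epsilon> * Psi n" by simp
  moreover have "2 * \<epsilon> * Psi n \<le> 2 * \<epsilon> * 2" using eps Psi by (intro mult_left_mono) auto
  ultimately have x4: "x \<le> 1 + 4 * \<epsilon>" by linarith
  have AG: "\<epsilon> * (A n - G n) \<ge> 0" using A_ge_G[of n] eps by simp
  have eA: "\<epsilon> * A n \<ge> 0" using A_nonneg[of n] eps by simp
  \<comment> \<open>Regrouping around \<open>A n\<close> separates the propagated excess from a term
    that is of second order, since \<open>x - 1\<close> is of order
    \<open>\<epsilon> * Psi n\<close>.\<close>
  have "x * (Psi n - \<epsilon> * G n) - \<epsilon> * (A n - G n) =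
      x * (Psi n - \<epsilon> * A n) + (x - 1) * (\<epsilon> * (A n - G n))"
    by (simp add: algebra_simps)
  also have "\<dots> \<le> (1 + 4 * \<epsilon>) * E + (2 * \<epsilon> * (E + \<epsilon> * A n)) * (\<epsilon> * A n)"
  proof (rule add_mono)
    have "x * (Psi n - \<epsilon> * A n) \<le> x * E" using E x1 by (intro mult_left_mono) auto
    also have "\<dots> \<le> (1 + 4 * \<epsilon>) * E" using E x4 by (intro mult_right_mono) auto
    finally show "x * (Psi n - \<epsilon> * A n) \<le> (1 + 4 * \<epsilon>) * E" .
    have "2 * \<epsilon> * Psi n \<le> 2 * \<epsilon> * (E + \<epsilon> * A n)" using E eps by (intro mult_left_mono) auto
    with x2 have "x - 1 \<le> 2 * \<epsilon> * (E + \<epsilon> * A n)" by linarith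
    moreover have "\<epsilon> * (A n - G n) \<le> \<epsilon> * A n" using G_ge_1[of n] eps by (intro mult_left_mono) auto
    ultimately show "(x - 1) * (\<epsilon> * (A n - G n)) \<le> (2 * \<epsilon> * (E + \<epsilon> * A n)) * (\<epsilon> * A n)"
      using A_ge_G[of n] AG x1 E eA eps by (intro mult_mono) auto
  qed
  also have "\<dots> = (1 + 4 * \<epsilon>) * E + 2 * \<epsilon> * E * (\<epsilon> * A n) + 2 * \<epsilon> ^ 3 * (A n)\<^sup>2"
    by (simp add: algebra_simps power2_eq_square power3_eq_cube)
  also have "2 * \<epsilon> * E * (\<epsilon> * A n) \<le> 2 * \<epsilon> * E * 1"
    using A E eps by (intro mult_left_mono) auto
  also have "2 * \<epsilon> ^ 3 * (A n)\<^sup>2 \<le> 2 * \<epsilon> ^ 3 * (Kap * (2 * (real m)\<^sup>2) * P n)"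
  proof -
    have "Kap * G n * P n \<le> Kap * (2 * (real m)\<^sup>2) * P n"
      using G_le[of n] Kap_pos P_pos[of n] by (intro mult_right_mono mult_left_mono) auto
    then show ?thesis using A_sq_le[of n] eps by (intro mult_left_mono) auto
  qed
  finally have main: "x * (Psi n - \<epsilon> * G n) - \<epsilon> * (A n - G n) \<le>
      (1 + 6 * \<epsilon>) * E + 4 * (real m)\<^sup>2 * \<epsilon> ^ 3 * Kap * P n" (is "_ \<le> ?B")
    by (simp add: algebra_simps)
  have B: "?B \<ge> 0" using E eps Kap_pos P_pos[of n] by simp
  have g: "G n ^ (m - 1) > 0" using G_ge_1[of n] by (intro zero_less_power) linarith
  have "Psi (Suc n) - \<epsilon> * A (Suc n) \<le> G n ^ (m - 1) * (x * (Psi n - \<epsilon> * G n) - \<epsilon> * (A n - G n))"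
    using Psi_Suc_le[of n] by (simp add: A_Suc x_def algebra_simps)
  also have "\<dots> \<le> G n ^ (m - 1) * ?B" using main g by (intro mult_left_mono) auto
  finally have "max 0 (Psi (Suc n) - \<epsilon> * A (Suc n)) \<le> G n ^ (m - 1) * ?B"
    using B g by simp
  then have "Exc (Suc n) \<le> G n ^ (m - 1) * ?B / P (Suc n)"
    unfolding Exc_def using P_pos[of "Suc n"] by (intro divide_right_mono) auto
  also have "\<dots> = ?B / P n"
  proof -
    have "e * b / (p * e) = b / p" if "e > 0" for e b p :: real using that by simp
    then show ?thesis unfolding P_Suc using g by blast
  qed
  also have "\<dots> = (1 + 6 * \<epsilon>) * Exc n + 4 * (real m)\<^sup>2 * \<epsilon> ^ 3 * Kap"
    using P_pos[of n] by (simp add: Exc_def E_def add_divide_distrib)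
  finally show ?thesis .
qed

text \<open>Taylor expansion in \<open>\<epsilon>\<close>: the constant term vanishes by criticality
  and \<open>\<epsilon> * A 0\<close> removes the linear one. With
  \<open>\<epsilon> * y \<le> 1\<close> the rest is at most a multiple of
  \<open>\<epsilon>^2 y^3\<close>.\<close>

lemma Exc_0_le:
  assumes supp: "\<And>y k. (y, k) \<in> set_pmf a0 \<Longrightarrow> \<epsilon> * y \<le> 1"
  shows "Exc 0 \<le> 3 * m * \<epsilon>\<^sup>2 * Lam"
proof -
  have "Psi 0 - \<epsilon> * A 0 = Psi 0 - psi_mom a0 m - \<epsilon> * A 0"
    using crit0 by (simp add: critical_law_def)
  also have "\<dots> = expec a0 (\<lambda>u. ((s\<^sub>\<epsilon> - 1) * real (fst u) - 1) * s\<^sub>\<epsilon> ^ fst u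
      - ((real m - 1) * real (fst u) - 1) * real m ^ fst u
      - \<epsilon> * (real m - 1) * (real (fst u) * (real (fst u) + 1) * real m ^ fst u))"
    unfolding Psi_def A_def psi_mom_def second_mom_def tmom_def
    by (simp add: integrable_finite_pmf fin0 mult.assoc)
  also have "\<dots> \<le> expec a0 (\<lambda>u. 3 * m * \<epsilon>\<^sup>2 * (real (fst u) ^ 3 * real m ^ fst u))"
  proof (rule expec_mono_finite[OF fin0])
    fix u assume u: "u \<in> set_pmf a0"
    define n where "n = fst u"
    define y where "y = real n"
    have ey: "\<epsilon> * y \<le> 1" "y \<ge> 0" using supp[of n "snd u"] u by (auto simp: n_def y_def)
    have M: "real m \<ge> 2" using m2 by simp
    have key: "((s\<^sub>\<epsilon> - 1) * y - 1) * (1 + \<epsilon>) ^ n - ((real m - 1) * y - 1)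
        - \<epsilon> * (real m - 1) * (y * (y + 1)) \<le> 3 * m * \<epsilon>\<^sup>2 * y ^ 3"
    proof (cases "n = 0")
      case False
      then have y1: "y \<ge> 1" by (simp add: y_def)
      have "(1 + \<epsilon>) ^ n \<le> exp \<epsilon> ^ n"
        using eps by (intro power_mono exp_ge_add_one_self) auto
      also have "\<dots> = exp (\<epsilon> * y)" by (simp add: y_def mult.commute[of \<epsilon>] exp_of_nat_mult)
      also have "\<dots> \<le> 1 + \<epsilon> * y + (\<epsilon> * y)\<^sup>2" using ey eps by (intro exp_bound) auto
      finally have pw: "(1 + \<epsilon>) ^ n \<le> 1 + \<epsilon> * y + (\<epsilon> * y)\<^sup>2" .
      have "1 * 1 \<le> (s\<^sub>\<epsilon> - 1) * y" using s_ge M y1 by (intro mult_mono) auto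
      then have "((s\<^sub>\<epsilon> - 1) * y - 1) * (1 + \<epsilon>) ^ n \<le> ((s\<^sub>\<epsilon> - 1) * y - 1) * (1 + \<epsilon> * y + (\<epsilon> * y)\<^sup>2)"
        using pw by (intro mult_left_mono) auto
      also have "\<dots> - ((real m - 1) * y - 1) - \<epsilon> * (real m - 1) * (y * (y + 1)) =
          \<epsilon>\<^sup>2 * ((real m - 1) * y ^ 3 + (real m - 1) * y\<^sup>2 + \<epsilon> * (m * y ^ 3))"
        by (simp add: s\<^sub>\<epsilon>_def algebra_simps power2_eq_square power3_eq_cube)
      also have "\<dots> \<le> \<epsilon>\<^sup>2 * (m * y ^ 3 + m * y ^ 3 + 1 * (m * y ^ 3))"
      proof (intro mult_left_mono add_mono)
        have "y\<^sup>2 \<le> y ^ 3" using y1 by (intro power_increasing) auto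
        then show "(real m - 1) * y\<^sup>2 \<le> m * y ^ 3" using M by (intro mult_mono) auto
      qed (use M y1 eps in \<open>auto intro!: mult_right_mono\<close>)
      also have "\<dots> = 3 * m * \<epsilon>\<^sup>2 * y ^ 3" by simp
      finally show ?thesis by linarith
    qed (simp add: y_def)
    have "s\<^sub>\<epsilon> ^ n = real m ^ n * (1 + \<epsilon>) ^ n" by (simp add: s\<^sub>\<epsilon>_def power_mult_distrib)
    then have "((s\<^sub>\<epsilon> - 1) * y - 1) * s\<^sub>\<epsilon> ^ n - ((real m - 1) * y - 1) * real m ^ n
      - \<epsilon> * (real m - 1) * (y * (y + 1) * real m ^ n) =
      real m ^ n * (((s\<^sub>\<epsilon> - 1) * y - 1) * (1 + \<epsilon>) ^ n - ((real m - 1) * y - 1)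
        - \<epsilon> * (real m - 1) * (y * (y + 1)))"
      by (simp add: algebra_simps)
    also have "\<dots> \<le> real m ^ n * (3 * m * \<epsilon>\<^sup>2 * y ^ 3)"
      by (intro mult_left_mono key) auto
    finally show "((s\<^sub>\<epsilon> - 1) * real (fst u) - 1) * s\<^sub>\<epsilon> ^ fst u
      - ((real m - 1) * real (fst u) - 1) * real m ^ fst u
      - \<epsilon> * (real m - 1) * (real (fst u) * (real (fst u) + 1) * real m ^ fst u)
      \<le> 3 * m * \<epsilon>\<^sup>2 * (real (fst u) ^ 3 * real m ^ fst u)"
      unfolding n_def[symmetric] y_def[symmetric] by (simp add: mult_ac)
  qed
  also have "\<dots> = 3 * m * \<epsilon>\<^sup>2 * Lam" by (simp add: Lam_def tmom_def)
  finally show ?thesis using Lam_pos by (simp add: Exc_def)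
qed

text \<open>A bootstrap: the bound on \<open>Exc k\<close> yields \<open>Psi k \<le> 2\<close>,
  which is what \<open>Exc_Suc_le\<close> needs to bound \<open>Exc (Suc k)\<close>. Over
  \<open>n \<le> 1 / \<epsilon>\<close> steps the factors \<open>1 + 6 * \<epsilon>\<close> multiply
  to at most \<open>exp 6\<close>.\<close>

lemma Psi_le_2:
  assumes supp: "\<And>y k. (y, k) \<in> set_pmf a0 \<Longrightarrow> \<epsilon> * y \<le> 1"
    and n: "n * \<epsilon> \<le> 1" and Th: "P n \<le> \<Theta>"
    and cond: "\<epsilon>\<^sup>2 * Lam * \<Theta> * (exp 6 * (3 * m + 16 * (real m)\<^sup>2 * (real m - 1) ^ 3)) \<le> 1"
    and k: "k \<le> n"
  shows "Psi k \<le> 2"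
proof -
  let ?C = "3 * m + 16 * (real m)\<^sup>2 * (real m - 1) ^ 3"
  define D where "D = 3 * m * \<epsilon>\<^sup>2 * Lam"
  define F where "F = 4 * (real m)\<^sup>2 * \<epsilon> ^ 3 * Kap"
  have Th0: "\<Theta> > 0" using Th P_pos[of n] by linarith
  have DF: "D \<ge> 0" "F \<ge> 0" using Lam_pos Kap_pos eps by (auto simp: D_def F_def)
  have PT: "P k \<le> \<Theta>" if "k \<le> n" for k using P_mono[OF that] Th by linarith
  have eA: "\<epsilon> * A k \<le> 1" if "k \<le> n" for k
  proof -
    have "(\<epsilon> * A k)\<^sup>2 = \<epsilon>\<^sup>2 * (A k)\<^sup>2" by (simp add: power_mult_distrib)
    also have "\<dots> \<le> \<epsilon>\<^sup>2 * (Kap * G k * P k)" by (intro mult_left_mono A_sq_le) auto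
    also have "\<dots> \<le> \<epsilon>\<^sup>2 * (Kap * (2 * (real m)\<^sup>2) * \<Theta>)"
      using G_le[of k] PT[OF that] Kap_pos P_pos[of k] G_ge_1[of k]
      by (intro mult_left_mono mult_mono) auto
    also have "\<dots> = \<epsilon>\<^sup>2 * Lam * \<Theta> * (1 * (8 * (real m)\<^sup>2 * (real m - 1) ^ 3))"
      by (simp add: Kap_def)
    also have "\<dots> \<le> \<epsilon>\<^sup>2 * Lam * \<Theta> * (exp 6 * ?C)"
      using Lam_pos Th0 m2 by (intro mult_left_mono mult_mono) (auto simp: add_increasing mult_right_mono)
    also have "\<dots> \<le> 1\<^sup>2" using cond by simp
    finally show ?thesis by (rule power2_le_imp_le) simp
  qed
  have ex: "(1 + 6 * \<epsilon>) ^ k * (D + k * F) \<le> \<epsilon>\<^sup>2 * Lam * (exp 6 * ?C)" if "k \<le> n" for k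
  proof -
    have "real k * \<epsilon> \<le> real n * \<epsilon>" using that eps by (intro mult_right_mono) auto
    then have ke: "real k * \<epsilon> \<le> 1" using n by linarith
    have "(1 + 6 * \<epsilon>) ^ k \<le> exp (6 * \<epsilon>) ^ k"
      using eps by (intro power_mono exp_ge_add_one_self) auto
    also have "\<dots> = exp (6 * (real k * \<epsilon>))" by (simp add: mult_ac flip: exp_of_nat_mult)
    also have "\<dots> \<le> exp 6" using ke by simp
    finally have 1: "(1 + 6 * \<epsilon>) ^ k \<le> exp 6" .
    \<comment> \<open>The number of steps absorbs one power of \<open>\<epsilon>\<close>, so the
      accumulated error has the same order \<open>\<epsilon>^2\<close> as the initial one.\<close>
    have "real k * F = (real k * \<epsilon>) * (4 * (real m)\<^sup>2 * \<epsilon>\<^sup>2 * Kap)"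
      by (simp add: F_def power2_eq_square power3_eq_cube)
    also have "\<dots> \<le> 1 * (4 * (real m)\<^sup>2 * \<epsilon>\<^sup>2 * Kap)"
      using ke Kap_pos by (intro mult_right_mono) auto
    finally have 2: "D + k * F \<le> \<epsilon>\<^sup>2 * Lam * ?C"
      by (simp add: D_def Kap_def algebra_simps)
    have "(1 + 6 * \<epsilon>) ^ k * (D + k * F) \<le> exp 6 * (\<epsilon>\<^sup>2 * Lam * ?C)"
      using 1 2 DF eps by (intro mult_mono) auto
    then show ?thesis by (simp only: mult_ac)
  qed
  have step: "Psi k \<le> 2" if "k \<le> n" "Exc k \<le> (1 + 6 * \<epsilon>) ^ k * (D + k * F)" for k
  proof -
    have "Exc k * P k \<le> \<epsilon>\<^sup>2 * Lam * (exp 6 * ?C) * \<Theta>"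
      using ex[OF that(1)] that(2) PT[OF that(1)] P_pos[of k] Exc_nonneg[of k] by (intro mult_mono) auto
    also have "\<dots> = \<epsilon>\<^sup>2 * Lam * \<Theta> * (exp 6 * ?C)" by (simp only: mult_ac)
    finally show ?thesis using cond Psi_le_Exc[of k] eA[OF that(1)] by linarith
  qed
  have "Exc k \<le> (1 + 6 * \<epsilon>) ^ k * (D + k * F)" if "k \<le> n" for k
    using that
  proof (induction k)
    case 0
    then show ?case using Exc_0_le[OF supp] by (simp add: D_def)
  next
    case (Suc k)
    let ?b = "1 + 6 * \<epsilon>"
    have IH: "Exc k \<le> ?b ^ k * (D + k * F)" using Suc by simp
    have b: "?b ^ Suc k \<ge> 1" using eps by (intro one_le_power) auto
    have "Exc (Suc k) \<le> ?b * Exc k + F"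
      unfolding F_def using Suc.prems IH by (intro Exc_Suc_le step eA) auto
    also have "\<dots> \<le> ?b * (?b ^ k * (D + k * F)) + ?b ^ Suc k * F"
      using IH eps b DF by (intro add_mono mult_left_mono) (auto simp: mult_le_cancel_right1)
    also have "\<dots> = ?b ^ Suc k * (D + Suc k * F)" by (simp add: algebra_simps)
    finally show ?case .
  qed
  then show ?thesis using step k by blast
qed

text \<open>Markov's inequality with the weight ratio \<open>(1 + \<epsilon>)^y\<close>. The moment
  \<open>E(Y s^Y)\<close> is bounded because it is at most \<open>Psi n + Gs n\<close>, and half of
  it absorbs the mean in \<open>tmom_one_le\<close>.\<close>

lemma tail_le:
  assumes "Psi n \<le> 2"
  shows "tmom (chain n) m (\<lambda>y k. (y + 1) * of_bool (y > real T)) \<le> (8 + 16 * (real m)\<^sup>2) / (1 + \<epsilon>) ^ T"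
proof -
  define h where "h = tmom (chain n) s\<^sub>\<epsilon> (\<lambda>y k. y)"
  have h0: "h \<ge> 0" unfolding h_def using s_ge_1 by (intro mean_nonneg) auto
  have "1 * h \<le> (s\<^sub>\<epsilon> - 1) * h" using h0 s_ge m2 by (intro mult_right_mono) auto
  also have "\<dots> = Psi n + Gs n" unfolding Psi_def h_def Gs_def by (simp add: psi_mom_eq[OF fin])
  also have "\<dots> \<le> 2 + (s\<^sub>\<epsilon>\<^sup>2 + h / 2)"
    using assms tmom_one_le[OF s_ge_1, of n] by (simp add: Gs_def h_def)
  finally have "h \<le> 4 + 2 * s\<^sub>\<epsilon>\<^sup>2" by simp
  also have "s\<^sub>\<epsilon>\<^sup>2 \<le> (real m * 2)\<^sup>2"
    using s_ge_1 eps unfolding s\<^sub>\<epsilon>_def by (intro power_mono mult_left_mono) auto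
  finally have h: "h \<le> 4 + 8 * (real m)\<^sup>2" by (simp add: power_mult_distrib)
  have "tmom (chain n) m (\<lambda>y k. (y + 1) * of_bool (y > real T)) \<le>
      expec (chain n) (\<lambda>u. 2 / (1 + \<epsilon>) ^ T * (real (fst u) * s\<^sub>\<epsilon> ^ fst u))"
    unfolding tmom_def
  proof (rule expec_mono_finite[OF fin])
    fix u :: "nat \<times> nat"
    define y where "y = fst u"
    show "(real (fst u) + 1) * of_bool (real (fst u) > real T) * real m ^ fst u
        \<le> 2 / (1 + \<epsilon>) ^ T * (real (fst u) * s\<^sub>\<epsilon> ^ fst u)"
    proof (cases "y > T")
      case True
      have "(1 + \<epsilon>) ^ T \<le> (1 + \<epsilon>) ^ y" using True eps by (intro power_increasing) auto
      then have "real m ^ y * (1 + \<epsilon>) ^ T \<le> s\<^sub>\<epsilon> ^ y"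
        unfolding s\<^sub>\<epsilon>_def power_mult_distrib by (intro mult_left_mono) auto
      then have "real m ^ y \<le> s\<^sub>\<epsilon> ^ y / (1 + \<epsilon>) ^ T" using eps by (simp add: field_simps)
      then have "(real y + 1) * real m ^ y \<le> (2 * real y) * (s\<^sub>\<epsilon> ^ y / (1 + \<epsilon>) ^ T)"
        using True s_ge_1 by (intro mult_mono) auto
      then show ?thesis using True by (simp add: y_def)
    next
      case False
      then show ?thesis using eps s_ge_1 by (simp add: y_def)
    qed
  qed
  also have "\<dots> = 2 / (1 + \<epsilon>) ^ T * h" by (simp add: h_def tmom_def)
  also have "\<dots> \<le> 2 / (1 + \<epsilon>) ^ T * (4 + 8 * (real m)\<^sup>2)"
    using h eps by (intro mult_left_mono) auto
  also have "\<dots> = (8 + 16 * (real m)\<^sup>2) / (1 + \<epsilon>) ^ T" by (simp add: add_divide_distrib)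
  finally show ?thesis .
qed

end

end

section \<open>Comparison with the recursive system\<close>

definition excess :: "nat \<Rightarrow> nat pmf \<Rightarrow> ennreal" where
  "excess t p = (\<integral>\<^sup>+ x. ennreal (real (x - t)) \<partial>measure_pmf p)"

lemma Enat_eq_excess: "Enat p = excess 0 p"
  by (simp add: Enat_def excess_def)

lemma rs_0 [simp]: "rs m p 0 = p"
  by (simp add: rs_def)

lemma rs_Suc: "rs m p (Suc n) = rs_step m (rs m p n)"
  by (simp add: rs_def)

lemma nn_integral_sum_copies_Suc:
  "(\<integral>\<^sup>+ s. f s \<partial>measure_pmf (sum_copies (Suc n) p)) =
   (\<integral>\<^sup>+ x. (\<integral>\<^sup>+ y. f (x + y) \<partial>measure_pmf (sum_copies n p)) \<partial>measure_pmf p)"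
  by (simp add: conv_pmf_def)

lemma nn_integral_pmf_add_const:
  "(\<integral>\<^sup>+ x. f x + c \<partial>measure_pmf p) = (\<integral>\<^sup>+ x. f x \<partial>measure_pmf p) + c"
  "(\<integral>\<^sup>+ x. c + f x \<partial>measure_pmf p) = c + (\<integral>\<^sup>+ x. f x \<partial>measure_pmf p)"
  by (simp_all add: nn_integral_add)

text \<open>Positive parts are superadditive here:
  \<open>(x - t)^+ + (y - t)^+ \<le> (x + y - t)^+\<close> for
  \<open>x, y, t \<ge> 0\<close>.\<close>

lemma excess_sum_copies_ge: "of_nat n * excess t p \<le> excess t (sum_copies n p)"
proof (induction n)
  case (Suc n)
  have "of_nat (Suc n) * excess t p = excess t p + of_nat n * excess t p"
    by (simp add: distrib_right)
  also have "\<dots> \<le> excess t p + excess t (sum_copies n p)"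
    by (intro add_left_mono Suc.IH)
  also have "\<dots> = (\<integral>\<^sup>+ x. (\<integral>\<^sup>+ y. ennreal (real (x - t)) + ennreal (real (y - t))
      \<partial>measure_pmf (sum_copies n p)) \<partial>measure_pmf p)"
    unfolding excess_def by (simp only: nn_integral_pmf_add_const)
  also have "\<dots> \<le> excess t (sum_copies (Suc n) p)"
    unfolding excess_def nn_integral_sum_copies_Suc
    by (intro nn_integral_mono) (simp flip: ennreal_plus)
  finally show ?case .
qed simp

lemma Enat_sum_copies: "Enat (sum_copies n p) = of_nat n * Enat p"
proof (induction n)
  case (Suc n)
  have "Enat (sum_copies (Suc n) p) = (\<integral>\<^sup>+ x. (\<integral>\<^sup>+ y. ennreal (real x) + ennreal (real y)
      \<partial>measure_pmf (sum_copies n p)) \<partial>measure_pmf p)"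
    unfolding Enat_def nn_integral_sum_copies_Suc by simp
  also have "\<dots> = Enat p + Enat (sum_copies n p)"
    unfolding Enat_def by (simp only: nn_integral_pmf_add_const)
  finally show ?case by (simp add: Suc.IH distrib_right)
qed (simp add: Enat_def)

lemma excess_rs_step: "excess t (rs_step m p) = excess (Suc t) (sum_copies m p)"
  by (simp add: excess_def rs_step_def)

text \<open>The excess over \<open>u\<close> after a step is the excess over \<open>u + 1\<close> of
  the sum of \<open>m\<close> copies. Each step thus trades one unit of the threshold for a factor
  \<open>m\<close>.\<close>

lemma excess_rs_ge: "of_nat m ^ t * excess (u + t) (rs m p n) \<le> excess u (rs m p (n + t))"
proof (induction t arbitrary: u)
  case (Suc t)
  have "of_nat m ^ Suc t * excess (u + Suc t) (rs m p n) =
      of_nat m * (of_nat m ^ t * excess (Suc u + t) (rs m p n))"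
    by (simp add: mult.assoc)
  also have "\<dots> \<le> of_nat m * excess (Suc u) (rs m p (n + t))"
    by (intro mult_left_mono Suc.IH) simp
  also have "\<dots> \<le> excess u (rs m p (n + Suc t))"
    using excess_sum_copies_ge by (simp add: rs_Suc excess_rs_step)
  finally show ?case .
qed simp

lemma Enat_rs_ge: "of_nat m ^ t * excess t (rs m p n) \<le> Enat (rs m p (n + t))"
  using excess_rs_ge[of m t 0 p n] by (simp add: Enat_eq_excess)

section \<open>Growth of the mean and the free energy\<close>

lemma Enat_rs_Suc_le: "Enat (rs m p (Suc n)) \<le> of_nat m * Enat (rs m p n)"
proof -
  have "Enat (rs_step m q) \<le> Enat (sum_copies m q)" for q
    unfolding Enat_def rs_step_def by (simp add: nn_integral_mono)
  then show ?thesis by (simp add: rs_Suc Enat_sum_copies[symmetric])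
qed

lemma Enat_rs_Suc_ge: "of_nat m * Enat (rs m p n) \<le> Enat (rs m p (Suc n)) + 1"
proof -
  have "Enat (sum_copies m q) \<le> (\<integral>\<^sup>+ x. ennreal (real (x - 1)) + 1 \<partial>measure_pmf (sum_copies m q))" for q
    unfolding Enat_def by (intro nn_integral_mono) (simp flip: ennreal_1 ennreal_plus)
  also have "\<dots> q = Enat (rs_step m q) + 1" for q
    unfolding nn_integral_pmf_add_const by (simp add: Enat_def rs_step_def)
  finally show ?thesis by (simp add: rs_Suc Enat_sum_copies[symmetric])
qed

text \<open>The mean satisfies \<open>e' \<ge> m e - 1\<close>; the offset \<open>1\<close>
  reproduces itself because \<open>m - 1 \<ge> 1\<close>.\<close>

lemma Enat_rs_growth:
  assumes m: "m \<ge> 2" and j: "Enat (rs m p j) \<ge> 2"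
  shows "Enat (rs m p (j + i)) \<ge> ennreal (real m ^ i + 1)"
proof (induction i)
  case (Suc i)
  have "ennreal (real m ^ Suc i + 1) + 1 = ennreal (real m ^ Suc i + 2)"
    by (simp flip: ennreal_1 ennreal_plus)
  also have "\<dots> \<le> ennreal (real m * (real m ^ i + 1))"
    using m by (intro ennreal_leI) (simp add: algebra_simps)
  also have "\<dots> = of_nat m * ennreal (real m ^ i + 1)"
    by (simp add: ennreal_mult ennreal_of_nat_eq_real_of_nat)
  also have "\<dots> \<le> of_nat m * Enat (rs m p (j + i))"
    by (intro mult_left_mono Suc.IH) simp
  also have "\<dots> \<le> Enat (rs m p (j + Suc i)) + 1"
    using Enat_rs_Suc_ge[of m p "j + i"] by simp
  finally show ?case by simp
qed (use j in simp)

lemma free_energy_ge: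
  assumes m: "m \<ge> 2" and j: "Enat (rs m p j) \<ge> 2"
  shows "free_energy m p \<ge> ennreal (1 / real m ^ j)"
proof -
  define e where "e = (\<lambda>n. Enat (rs m p n) / ennreal (real m ^ n))"
  have "e (Suc n) \<le> e n" for n
  proof -
    have "e (Suc n) \<le> (of_nat m * Enat (rs m p n)) / ennreal (real m ^ Suc n)"
      unfolding e_def by (intro divide_right_mono_ennreal Enat_rs_Suc_le)
    also have "\<dots> = (ennreal (real m) * Enat (rs m p n)) / (ennreal (real m) * ennreal (real m ^ n))"
      by (simp add: ennreal_mult ennreal_of_nat_eq_real_of_nat)
    also have "\<dots> = e n"
      unfolding e_def using m divide_mult_eq[of "ennreal (real m)" "Enat (rs m p n)" "ennreal (real m ^ n)"]
      by (simp add: mult.commute[of "ennreal (real m)"])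
    finally show ?thesis .
  qed
  \<comment> \<open>The normalised means decrease, so the limit in \<open>free_energy\<close> exists
    and is their infimum; it suffices to bound each term.\<close>
  then have "decseq e" by (rule decseq_SucI)
  then have "e \<longlonglongrightarrow> (INF n. e n)" by (rule LIMSEQ_INF)
  then have lim: "free_energy m p = (INF n. e n)"
    unfolding free_energy_def e_def[symmetric] by (rule limI)
  have ge: "ennreal (1 / real m ^ j) \<le> e (j + i)" for i
  proof -
    have "ennreal (1 / real m ^ j) = ennreal (real m ^ i / real m ^ (j + i))"
      using m by (simp add: power_add)
    also have "\<dots> = ennreal (real m ^ i) / ennreal (real m ^ (j + i))"
      using m by (intro divide_ennreal[symmetric]) auto
    also have "\<dots> \<le> e (j + i)"
      unfolding e_def using Enat_rs_growth[OF m j, of i]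
      by (intro divide_right_mono_ennreal) (meson ennreal_leI order_trans le_add_same_cancel1 zero_le_one)
    finally show ?thesis .
  qed
  show ?thesis unfolding lim
  proof (rule INF_greatest)
    fix n
    have "e (j + n) \<le> e n" using \<open>decseq e\<close> by (auto simp: decseq_def)
    with ge[of n] show "ennreal (1 / real m ^ j) \<le> e n" by order
  qed
qed

section \<open>Couplings of marked chains with the recursive system\<close>

text \<open>Under \<open>rel_pmf\<close> this asserts a coupling in which value plus mark is at most
  the dominating variable, that is, stochastic domination.\<close>

definition below :: "nat \<times> nat \<Rightarrow> nat \<Rightarrow> bool" where
  "below u x \<longleftrightarrow> fst u + snd u \<le> x"

lemma rel_pmf_iid_sum: "rel_pmf below a p \<Longrightarrow> rel_pmf below (iid_sum n a) (sum_copies n p)"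
proof (induction n)
  case (Suc n)
  show ?case
    unfolding iid_sum.simps sum_copies.simps add_pmf_def conv_pmf_def
    by (rule rel_pmf_bindI[OF Suc.prems])
      (auto simp: pmf.rel_map below_def intro!: pmf.rel_mono_strong[OF Suc.IH[OF Suc.prems]])
qed (simp add: below_def)

lemma rel_pmf_marked_step: "rel_pmf below a p \<Longrightarrow> rel_pmf below (marked_step m r a) (rs_step m p)"
  unfolding marked_step_def rs_step_def pmf.rel_map
  by (rule pmf.rel_mono_strong[OF rel_pmf_iid_sum]) (auto simp: below_def)

lemma rel_pmf_chain:
  "rel_pmf below a p \<Longrightarrow> rel_pmf below ((marked_step m r ^^ n) a) (rs m p n)"
  by (induction n) (simp_all add: rs_Suc rel_pmf_marked_step)

lemma rel_pmf_nn_integral_mono: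
  assumes "rel_pmf R a p" "\<And>u x. R u x \<Longrightarrow> f u \<le> g x"
  shows "(\<integral>\<^sup>+ u. f u \<partial>measure_pmf a) \<le> (\<integral>\<^sup>+ x. g x \<partial>measure_pmf p)"
  using assms(1)
proof (cases rule: rel_pmf.cases)
  case (1 pq)
  have "(\<integral>\<^sup>+ u. f (fst u) \<partial>measure_pmf pq) \<le> (\<integral>\<^sup>+ u. g (snd u) \<partial>measure_pmf pq)"
    using 1 assms(2) by (intro nn_integral_mono_AE) (auto simp: AE_measure_pmf_iff)
  then show ?thesis using 1 by (auto simp flip: 1)
qed

context critical_chain
begin

text \<open>If the mark is \<open>r\<close> and the value is \<open>y \<le> T\<close>, the
  dominating variable exceeds \<open>t = y + r - 1\<close> by at least one. Since
  \<open>m^t E(X - t)^+ < 2\<close> for every \<open>t \<le> T + r\<close>, the weight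
  \<open>m^y = m * m^t / m^r\<close> is small in expectation. Values above \<open>T\<close> are left
  to the tail term.\<close>

lemma full_mass_le:
  assumes rel: "rel_pmf below a0 X"
    and less: "\<And>t. t \<le> T + r \<Longrightarrow> Enat (rs m X (k + t)) < 2"
  shows "full_mass m r (chain k) \<le> tmom (chain k) m (\<lambda>y j. (y + 1) * of_bool (y > real T))
    + 2 * real m * (real T + 1) * (real T + real r + 1) / real m ^ r"
proof -
  define S where "S = (\<lambda>u. \<Sum>t\<le>T + r. real m ^ t * real (fst u + snd u - t))"
  have bound: "real m ^ t * expec (chain k) (\<lambda>u. real (fst u + snd u - t)) \<le> 2" if "t \<le> T + r" for t
  proof -
    have "ennreal (real m ^ t * expec (chain k) (\<lambda>u. real (fst u + snd u - t))) =
      of_nat m ^ t * (\<integral>\<^sup>+ u. ennreal (real (fst u + snd u - t)) \<partial>measure_pmf (chain k))"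
      by (subst nn_integral_eq_integral)
        (auto simp: integrable_finite_pmf fin ennreal_mult ennreal_of_nat_eq_real_of_nat ennreal_power)
    also have "\<dots> \<le> of_nat m ^ t * excess t (rs m X k)"
      unfolding excess_def chain_def
      by (intro mult_left_mono rel_pmf_nn_integral_mono[OF rel_pmf_chain[OF rel]])
        (auto simp: below_def intro!: ennreal_leI diff_le_mono)
    also have "\<dots> \<le> Enat (rs m X (k + t))" by (rule Enat_rs_ge)
    also have "\<dots> \<le> 2" using less[OF that] by simp
    finally show ?thesis by (simp flip: ennreal_numeral)
  qed
  have "expec (chain k) S = (\<Sum>t\<le>T + r. real m ^ t * expec (chain k) (\<lambda>u. real (fst u + snd u - t)))"
    unfolding S_def by (simp add: integrable_finite_pmf fin)
  also have "\<dots> \<le> (\<Sum>t\<le>T + r. 2)" using bound by (intro sum_mono) auto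
  finally have ES: "expec (chain k) S \<le> 2 * (real T + real r + 1)" by simp
  have S0: "S u \<ge> 0" for u unfolding S_def by (intro sum_nonneg) auto
  have "full_mass m r (chain k) \<le> expec (chain k) (\<lambda>u. (real (fst u) + 1) * of_bool (real (fst u) > real T) * real m ^ fst u
      + (real T + 1) * real m / real m ^ r * S u)"
    unfolding full_mass_def tmom_def
  proof (rule expec_mono_finite[OF fin])
    fix u :: "nat \<times> nat"
    obtain y j where u: "u = (y, j)" by (cases u)
    show "(real (fst u) + 1) * of_bool (real (snd u) = real r) * real m ^ fst u \<le>
      (real (fst u) + 1) * of_bool (real (fst u) > real T) * real m ^ fst u + (real T + 1) * real m / real m ^ r * S u"
    proof (cases "j = r \<and> y \<le> T")
      case True
      \<comment> \<open>Only the summand \<open>t = y + r - 1\<close> is kept; there the difference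
        equals exactly \<open>1\<close>.\<close>
      have "real m ^ (y + r - 1) * real (fst u + snd u - (y + r - 1)) \<le> S u"
        unfolding S_def using True by (intro member_le_sum) auto
      then have "real m ^ (y + r - 1) \<le> S u" using True r1 by (simp add: u)
      then have "real m * real m ^ (y + r - 1) \<le> real m * S u" by (intro mult_left_mono) auto
      moreover have "real m * real m ^ (y + r - 1) = real m ^ y * real m ^ r"
        using r1 by (cases r) (simp_all add: power_add)
      ultimately have "real m ^ y * real m ^ r \<le> m * S u" by linarith
      then have "real m ^ y \<le> real m / real m ^ r * S u" using m2 by (simp add: pos_le_divide_eq)
      then have "(real y + 1) * real m ^ y \<le> (real T + 1) * (real m / real m ^ r * S u)"
        using True by (intro mult_mono) auto
      then show ?thesis using True by (simp add: u)
    next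
      case False
      then show ?thesis using S0[of u] by (auto simp: u)
    qed
  qed
  also have "\<dots> = tmom (chain k) m (\<lambda>y j. (y + 1) * of_bool (y > real T)) + (real T + 1) * real m / real m ^ r * expec (chain k) S"
    unfolding tmom_def by (simp add: integrable_finite_pmf fin)
  also have "\<dots> \<le> tmom (chain k) m (\<lambda>y j. (y + 1) * of_bool (y > real T))
    + (real T + 1) * real m / real m ^ r * (2 * (real T + real r + 1))"
    using ES by (intro add_left_mono mult_left_mono) auto
  finally show ?thesis by (simp only: times_divide_eq_left times_divide_eq_right mult_ac)
qed

end

section \<open>Cutting off while preserving criticality\<close>

text \<open>Large values go to \<open>0\<close> rather than to \<open>K\<close>, which leaves the
  masses at \<open>1, ..., K\<close> unchanged.\<close>

definition truncate_pmf :: "nat \<Rightarrow> nat pmf \<Rightarrow> nat pmf" where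
  "truncate_pmf K p = map_pmf (\<lambda>x. if x \<le> K then x else 0) p"

lemma set_truncate_pmf: "set_pmf (truncate_pmf K p) \<subseteq> {..K}"
  by (auto simp: truncate_pmf_def)

lemma pmf_truncate_pmf:
  assumes "1 \<le> x" "x \<le> K"
  shows "pmf (truncate_pmf K p) x = pmf p x"
proof -
  have "(\<lambda>x. if x \<le> K then x else 0) -` {x} = {x}" using assms by (auto split: if_splits)
  then show ?thesis by (simp add: truncate_pmf_def pmf_map measure_pmf_single)
qed

text \<open>Given \<open>x\<close> with law \<open>X\<close> cut off at \<open>K\<close>, a coin decides whether \<open>x\<close> becomes the value
  of the dominated critical system or an extra mark on a zero of that system.\<close>

definition split_pmf :: "(nat \<Rightarrow> real) \<Rightarrow> nat \<Rightarrow> nat \<Rightarrow> nat pmf \<Rightarrow> (nat \<times> nat) pmf" where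
  "split_pmf w r K X = bind_pmf (truncate_pmf K X) (\<lambda>x.
     map_pmf (\<lambda>b. if b then (x, 0) else (0, min x r)) (bernoulli_pmf (w x / pmf X x)))"

lemma set_split_pmf: "set_pmf (split_pmf w r K X) \<subseteq> {..K} \<times> {..r}"
  using set_truncate_pmf[of K X] by (auto simp: split_pmf_def split: if_splits)

text \<open>Both sides are fed the same \<open>x\<close>: cutting it off, keeping it as a value or
  turning it into a capped mark never exceeds \<open>x\<close>.\<close>

lemma rel_split_pmf: "rel_pmf below (split_pmf w r K X) X"
proof -
  have "rel_pmf below (split_pmf w r K X) (bind_pmf X return_pmf)"
    unfolding split_pmf_def truncate_pmf_def bind_map_pmf
    by (rule rel_pmf_bindI[where R="(=)"])
      (auto simp: pmf.rel_eq rel_pmf_return_pmf2 below_def split: if_splits)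
  then show ?thesis by (simp add: bind_return_pmf')
qed

text \<open>The mass at \<open>0\<close> is eliminated by total mass one, hence the increments over
  \<open>h (0, 0)\<close>; the laws are compared only at points \<open>x \<ge> 1\<close>.\<close>

lemma expec_split_pmf:
  fixes h :: "nat \<times> nat \<Rightarrow> real"
  assumes w: "\<forall>x\<ge>1. 0 \<le> w x \<and> w x \<le> pmf X x"
  shows "expec (split_pmf w r K X) h = h (0, 0) + (\<Sum>x=1..K.
    (h (x, 0) - h (0, 0)) * w x + (h (0, min x r) - h (0, 0)) * (pmf X x - w x))"
proof -
  let ?X = "truncate_pmf K X"
  let ?f = "\<lambda>x. map_pmf (\<lambda>b. if b then (x, 0) else (0, min x r)) (bernoulli_pmf (w x / pmf X x))"
  have split: "{..K} = insert 0 {1..K}" by auto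
  have "expec (split_pmf w r K X) h = (\<Sum>x\<in>{..K}. pmf ?X x *\<^sub>R expec (?f x) h)"
    unfolding split_pmf_def by (intro pmf_expectation_bind set_truncate_pmf) auto
  also have "\<dots> = pmf ?X 0 * expec (?f 0) h + (\<Sum>x=1..K. pmf ?X x * expec (?f x) h)"
    unfolding split by simp
  also have "expec (?f 0) h = h (0, 0)"
    by (simp add: if_distrib cong: if_cong)
  also have "(\<Sum>x=1..K. pmf ?X x * expec (?f x) h) =
      (\<Sum>x=1..K. h (x, 0) * w x + h (0, min x r) * (pmf X x - w x))"
  proof (rule sum.cong[OF refl])
    fix x assume x: "x \<in> {1..K}"
    define p where "p = w x / pmf X x"
    have p: "0 \<le> p" "p \<le> 1" using w[rule_format, of x] x by (auto simp: p_def divide_le_eq_1)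
    \<comment> \<open>If \<open>pmf X x = 0\<close>, then \<open>p = 0\<close> by the convention for
      division, and \<open>w x = 0\<close> as well.\<close>
    have Xp: "pmf X x * p = w x" using w[rule_format, of x] x by (auto simp: p_def)
    have e: "expec (?f x) h = p * h (x, 0) + (1 - p) * h (0, min x r)"
      unfolding p_def[symmetric] using p by (simp add: integral_bernoulli_pmf mult.commute)
    have "pmf ?X x = pmf X x" using x by (simp add: pmf_truncate_pmf)
    then have "pmf ?X x * expec (?f x) h = pmf X x * (p * h (x, 0) + (1 - p) * h (0, min x r))"
      by (simp only: e)
    also have "\<dots> = (pmf X x * p) * h (x, 0) + (pmf X x - pmf X x * p) * h (0, min x r)"
      by (simp add: algebra_simps)
    finally show "pmf ?X x * expec (?f x) h = h (x, 0) * w x + h (0, min x r) * (pmf X x - w x)"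
      unfolding Xp by (simp add: mult.commute)
  qed
  also have "pmf ?X 0 = 1 - (\<Sum>x=1..K. pmf X x)"
  proof -
    have "(\<Sum>x\<in>{..K}. pmf ?X x) = 1"
      using set_truncate_pmf by (intro sum_pmf_eq_1) auto
    moreover have "(\<Sum>x=1..K. pmf ?X x) = (\<Sum>x=1..K. pmf X x)"
      by (intro sum.cong) (auto simp: pmf_truncate_pmf)
    ultimately show ?thesis unfolding split by simp
  qed
  finally show ?thesis
    by (simp add: algebra_simps sum.distrib sum_subtractf sum_distrib_left)
qed

lemma tmom_split_pmf:
  assumes w: "\<forall>x\<ge>1. 0 \<le> w x \<and> w x \<le> pmf X x"
  shows "tmom (split_pmf w r K X) s f = f 0 0 + (\<Sum>x=1..K.
    (f x 0 * s ^ x - f 0 0) * w x + (f 0 (min x r) - f 0 0) * (pmf X x - w x))"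
  unfolding tmom_def by (subst expec_split_pmf[OF w]) (auto simp: of_nat_min)

section \<open>Criticality as a sum over positive values\<close>

text \<open>The integrand of \<open>psi_mom\<close> at \<open>s = m\<close>, plus \<open>1\<close>
  so that it vanishes at \<open>0\<close>. Criticality then says that \<open>psi\<close> has
  expectation one, whatever the mass at \<open>0\<close>.\<close>

definition psi :: "nat \<Rightarrow> nat \<Rightarrow> real" where
  "psi m x = ((real m - 1) * x - 1) * real m ^ x + 1"

lemma psi_0 [simp]: "psi m 0 = 0"
  by (simp add: psi_def)

text \<open>The first bound limits the third moment of surplus moved to the critical law, the second
  compares \<open>psi\<close> with the surplus of the mean.\<close>

lemma psi_ge:
  assumes m: "m \<ge> 2"
  shows "real x * real m ^ x \<le> 2 * psi m x" and "real x \<le> psi m x"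
proof -
  show 1: "real x * real m ^ x \<le> 2 * psi m x"
  proof (cases "x \<le> 1")
    case True
    then consider "x = 0" | "x = 1" by linarith
    then show ?thesis
    proof cases
      case 2
      define z where "z = real m - 2"
      have z: "z \<ge> 0" "real m = z + 2" using m by (auto simp: z_def)
      show ?thesis unfolding psi_def 2 z(2) using z(1) by (simp add: algebra_simps)
    qed simp
  next
    case False
    then have "real x \<le> 2 * (1 * real x - 1)" by simp
    also have "\<dots> \<le> 2 * ((real m - 1) * x - 1)" using m by (intro mult_left_mono diff_mono mult_right_mono) auto
    finally have "real x * real m ^ x \<le> 2 * ((real m - 1) * x - 1) * real m ^ x"
      by (intro mult_right_mono) auto
    then show ?thesis by (simp add: psi_def algebra_simps)
  qed
  show "real x \<le> psi m x"
  proof (cases "x = 0")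
    case False
    have "(2::real) ^ 1 \<le> 2 ^ x" using False by (intro power_increasing) auto
    also have "\<dots> \<le> real m ^ x" using m by (intro power_mono) auto
    finally have "real x * 2 \<le> real x * real m ^ x" by (intro mult_left_mono) auto
    with 1 show ?thesis by linarith
  qed simp
qed

lemma psi_le:
  assumes "m \<ge> 2"
  shows "psi m x \<le> (real m - 1) * (x * real m ^ x)"
  using assms one_le_power[of "real m" x] by (simp add: psi_def algebra_simps)

lemma psi_nonneg: "m \<ge> 2 \<Longrightarrow> psi m x \<ge> 0"
  using psi_ge(2)[of m x] by (meson of_nat_0_le_iff order_trans)

lemma split_pmf_moments:
  assumes w: "\<forall>x\<ge>1. 0 \<le> w x \<and> w x \<le> pmf X x"
  shows "psi_mom (split_pmf w r K X) m = (\<Sum>x=1..K. psi m x * w x) - 1"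
    and "tmom (split_pmf w r K X) m (\<lambda>y k. y ^ 3) = (\<Sum>x=1..K. real x ^ 3 * real m ^ x * w x)"
    and "mark_mass m (split_pmf w r K X) = (\<Sum>x=1..K. real (min x r) * (pmf X x - w x))"
  unfolding psi_mom_def mark_mass_def tmom_split_pmf[OF w] psi_def by (simp_all add: of_nat_min)

lemma sum_pmf_eq_expec:
  fixes g :: "nat \<Rightarrow> real"
  shows "(\<Sum>x=1..K. g x * pmf p x) = expec p (\<lambda>x. g x * of_bool (1 \<le> x \<and> x \<le> K))"
  by (subst integral_measure_pmf[where A="{1..K}"]) (auto intro!: sum.cong)

lemma integrable_of_bool_mult:
  fixes g :: "nat \<Rightarrow> real"
  assumes "integrable (measure_pmf p) g"
  shows "integrable (measure_pmf p) (\<lambda>x. g x * of_bool (Q x))"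
  by (rule Bochner_Integration.integrable_bound[OF assms]) auto

context
  fixes m :: nat and Y :: "nat pmf"
  assumes m2: "m \<ge> 2" and Lam_fin: "Lambda m Y < \<infinity>"
begin

lemma integrable_cube: "integrable (measure_pmf Y) (\<lambda>z. real z ^ 3 * real m ^ z)"
  using Lam_fin unfolding Lambda_def by (intro integrableI_nonneg) auto

lemma Lambda_eq_expec: "enn2real (Lambda m Y) = expec Y (\<lambda>z. real z ^ 3 * real m ^ z)"
  unfolding Lambda_def by (rule integral_eq_nn_integral[symmetric]) auto

lemma integrable_power_m: "integrable (measure_pmf Y) (\<lambda>z. real m ^ z)"
proof (rule Bochner_Integration.integrable_bound)
  show "integrable (measure_pmf Y) (\<lambda>z. 1 + real z ^ 3 * real m ^ z)"
    using integrable_cube by simp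
  have "real m ^ z \<le> 1 + real z ^ 3 * real m ^ z" for z
  proof (cases "z = 0")
    case False
    then have "1 * real m ^ z \<le> real z ^ 3 * real m ^ z" by (intro mult_right_mono one_le_power) auto
    then show ?thesis by simp
  qed simp
  then show "AE z in measure_pmf Y. norm (real m ^ z) \<le> norm (1 + real z ^ 3 * real m ^ z)"
    by (intro AE_I2) (simp add: order_trans[OF _ abs_ge_self])
qed simp

lemma mult_le_cube: "real z * real m ^ z \<le> real z ^ 3 * real m ^ z"
proof (cases "z = 0")
  case False
  then have "real z ^ 1 \<le> real z ^ 3" by (intro power_increasing) auto
  then show ?thesis by (intro mult_right_mono) auto
qed simp

lemma integrable_mult_power_m: "integrable (measure_pmf Y) (\<lambda>z. real z * real m ^ z)"
  by (rule Bochner_Integration.integrable_bound[OF integrable_cube]) (use mult_le_cube in auto)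

lemma integrable_psi: "integrable (measure_pmf Y) (psi m)"
  unfolding psi_def left_diff_distrib mult_1 mult.assoc
  using integrable_power_m integrable_mult_power_m by simp

context
  assumes crit: "(real m - 1) * expec Y (\<lambda>z. real z * real m ^ z) = expec Y (\<lambda>z. real m ^ z)"
begin

lemma expec_psi: "expec Y (psi m) = 1"
proof -
  have "psi m = (\<lambda>z. (real m - 1) * (real z * real m ^ z) - real m ^ z + 1)"
    by (simp add: fun_eq_iff psi_def algebra_simps)
  then show ?thesis
    using crit integrable_power_m integrable_mult_power_m by simp
qed

text \<open>Chain the inequalities \<open>1 \<le> E(m^Y) = (m - 1) E(Y m^Y)\<close> and
  \<open>y \<le> y^3\<close>.\<close>

lemma Lambda_ge: "1 \<le> (real m - 1) * enn2real (Lambda m Y)"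
proof -
  have "1 = expec Y (\<lambda>z. 1 :: real)" by simp
  also have "\<dots> \<le> expec Y (\<lambda>z. real m ^ z)"
    using m2 integrable_power_m by (intro integral_mono) (auto intro: one_le_power)
  also have "\<dots> = (real m - 1) * expec Y (\<lambda>z. real z * real m ^ z)" using crit by simp
  also have "\<dots> \<le> (real m - 1) * enn2real (Lambda m Y)"
    unfolding Lambda_eq_expec using m2 mult_le_cube
    by (intro mult_left_mono integral_mono integrable_mult_power_m integrable_cube) auto
  finally show ?thesis .
qed

text \<open>The deficit after cutting at \<open>K\<close> is the expectation of \<open>psi\<close>
  beyond \<open>K\<close>, where \<open>K^2 * psi m x \<le> (m - 1) x^3 m^x\<close>.\<close>

lemma psi_deficit:
  shows "(\<Sum>x=1..K. psi m x * pmf Y x) \<le> 1"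
    and "(real K)\<^sup>2 * (1 - (\<Sum>x=1..K. psi m x * pmf Y x)) \<le> (real m - 1) * enn2real (Lambda m Y)"
    and "(\<Sum>x=1..K. real x ^ 3 * real m ^ x * pmf Y x) \<le> enn2real (Lambda m Y)"
proof -
  have eq: "1 - (\<Sum>x=1..K. psi m x * pmf Y x) = expec Y (\<lambda>x. psi m x * of_bool (x > K))"
  proof -
    have "psi m x = psi m x * of_bool (1 \<le> x \<and> x \<le> K) + psi m x * of_bool (x > K)" for x
      by (cases "x = 0") auto
    then have "expec Y (psi m) = expec Y (\<lambda>x. psi m x * of_bool (1 \<le> x \<and> x \<le> K) + psi m x * of_bool (x > K))"
      by presburger
    also have "\<dots> = (\<Sum>x=1..K. psi m x * pmf Y x) + expec Y (\<lambda>x. psi m x * of_bool (x > K))"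
      unfolding sum_pmf_eq_expec
      by (rule Bochner_Integration.integral_add) (intro integrable_of_bool_mult integrable_psi)+
    finally show ?thesis by (simp add: expec_psi)
  qed
  have "0 \<le> expec Y (\<lambda>x. psi m x * of_bool (x > K))"
    using psi_nonneg[OF m2] by (intro integral_nonneg_AE) auto
  then show "(\<Sum>x=1..K. psi m x * pmf Y x) \<le> 1" using eq by simp
  have "(real K)\<^sup>2 * expec Y (\<lambda>x. psi m x * of_bool (x > K)) =
      expec Y (\<lambda>x. (real K)\<^sup>2 * (psi m x * of_bool (x > K)))" by simp
  also have "\<dots> \<le> expec Y (\<lambda>x. (real m - 1) * (real x ^ 3 * real m ^ x))"
  proof (intro integral_mono)
    fix x
    show "(real K)\<^sup>2 * (psi m x * of_bool (x > K)) \<le> (real m - 1) * (real x ^ 3 * real m ^ x)"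
    proof (cases "x > K")
      case True
      have "(real K)\<^sup>2 * psi m x \<le> (real x)\<^sup>2 * ((real m - 1) * (x * real m ^ x))"
        using True psi_le[OF m2, of x] psi_nonneg[OF m2, of x] by (intro mult_mono power_mono) auto
      then show ?thesis using True by (simp add: power2_eq_square power3_eq_cube mult_ac)
    qed (use m2 in simp)
  qed (use integrable_cube integrable_of_bool_mult[OF integrable_psi] in auto)
  finally show "(real K)\<^sup>2 * (1 - (\<Sum>x=1..K. psi m x * pmf Y x)) \<le> (real m - 1) * enn2real (Lambda m Y)"
    unfolding eq Lambda_eq_expec by simp
  show "(\<Sum>x=1..K. real x ^ 3 * real m ^ x * pmf Y x) \<le> enn2real (Lambda m Y)"
    unfolding sum_pmf_eq_expec Lambda_eq_expec
    by (intro integral_mono integrable_cube integrable_of_bool_mult) auto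
qed

text \<open>Without an atom at \<open>0\<close>, \<open>psi\<close> would be at least one almost
  surely with expectation one, hence equal to one. This excludes all values
  \<open>\<ge> 2\<close>.\<close>

lemma pmf_0_pos:
  assumes "measure_pmf.prob Y {2..} > 0"
  shows "pmf Y 0 > 0"
proof (rule ccontr)
  assume "\<not> pmf Y 0 > 0"
  then have "pmf Y 0 = 0" using pmf_nonneg[of Y 0] by linarith
  then have Y0: "0 \<notin> set_pmf Y" by (simp add: set_pmf_iff)
  have pos: "AE z in measure_pmf Y. 0 \<le> psi m z - 1"
  proof (unfold AE_measure_pmf_iff, rule ballI)
    fix z assume "z \<in> set_pmf Y"
    then have "z \<ge> 1" using Y0 by (cases z) auto
    then have "1 \<le> (real m - 1) * real z" using m2 mult_mono[of 1 "real m - 1" 1 "real z"] by simp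
    then show "0 \<le> psi m z - 1" by (simp add: psi_def)
  qed
  have "expec Y (\<lambda>z. psi m z - 1) = 0" using expec_psi integrable_psi by simp
  then have "AE z in measure_pmf Y. psi m z - 1 = 0"
    using integral_nonneg_eq_0_iff_AE[OF _ pos] integrable_psi by simp
  moreover have "psi m z - 1 \<noteq> 0" if "z \<ge> 2" for z
    using that m2 mult_mono[of 1 "real m - 1" 2 "real z"] by (simp add: psi_def)
  ultimately have "set_pmf Y \<inter> {2..} = {}" by (auto simp: AE_measure_pmf_iff)
  then have "measure_pmf.prob Y {2..} = 0" by (simp add: measure_pmf_zero_iff)
  with assms show False by simp
qed

end

end

section \<open>Localising the surplus and building the initial marked law\<close>

text \<open>Since \<open>x \<le> 2 (x - t)\<close> for \<open>x > 2 t\<close>, values above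
  \<open>2 t\<close> contribute at most \<open>2 * \<eta> / 8\<close> to the mean of
  \<open>X\<close>.\<close>

lemma sum_mean_difference:
  assumes EX: "Enat X \<ge> Enat Y + ennreal \<eta>" and \<eta>: "\<eta> > 0" and ex: "excess t X \<le> ennreal (\<eta> / 8)"
  shows "\<eta> / 2 \<le> (\<Sum>x=1..2 * t. real x * (pmf X x - pmf Y x))"
proof -
  define SX where "SX p = (\<Sum>x=1..2 * t. real x * pmf p x)" for p
  have SX0: "SX p \<ge> 0" for p unfolding SX_def by (intro sum_nonneg) auto
  have nn: "(\<integral>\<^sup>+ x. ennreal (real x * of_bool (1 \<le> x \<and> x \<le> 2 * t)) \<partial>measure_pmf p) = ennreal (SX p)" for p
    unfolding SX_def sum_pmf_eq_expec
    by (intro nn_integral_eq_integral measure_pmf.integrable_const_bound[where B="real (2 * t)"]) auto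
  have "ennreal (SX Y) \<le> Enat Y"
    unfolding nn[symmetric] Enat_def by (intro nn_integral_mono) auto
  then have "ennreal (SX Y) + ennreal \<eta> \<le> Enat X"
    using EX by (meson add_right_mono order_trans)
  also have "Enat X \<le> (\<integral>\<^sup>+ x. ennreal (real x * of_bool (1 \<le> x \<and> x \<le> 2 * t)) + 2 * ennreal (real (x - t)) \<partial>measure_pmf X)"
    unfolding Enat_def
    by (intro nn_integral_mono) (auto simp flip: ennreal_plus ennreal_mult'' ennreal_numeral)
  also have "\<dots> = ennreal (SX X) + 2 * excess t X"
    using nn[of X] by (simp add: nn_integral_add nn_integral_cmult excess_def)
  also have "\<dots> \<le> ennreal (SX X) + 2 * ennreal (\<eta> / 8)"
    by (intro add_left_mono mult_left_mono ex) auto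
  also have "\<dots> = ennreal (SX X + \<eta> / 4)"
    using SX0[of X] \<eta> by (simp flip: ennreal_plus ennreal_mult'' ennreal_numeral)
  finally have "SX Y + \<eta> \<le> SX X + \<eta> / 4"
    using SX0 \<eta> by (simp flip: ennreal_plus)
  then show ?thesis using \<eta> by (simp add: SX_def sum_subtractf algebra_simps)
qed

text \<open>Exponential growth beats powers. The base \<open>3\<close> is the later lower bound for
  \<open>R\<close>, and \<open>7\<close> powers of \<open>R\<close> are kept aside.\<close>

lemma exists_exponent:
  fixes C :: real
  assumes "C > 0"
  obtains A :: nat where "A \<ge> k" "A \<ge> 8" "C * real A ^ 6 \<le> 3 ^ (A - 7)"
proof -
  have "eventually (\<lambda>n::nat. C * real n ^ 6 \<le> 3 ^ n / 3 ^ 7) at_top"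
    using assms by real_asymp
  moreover have "eventually (\<lambda>n. n \<ge> k \<and> n \<ge> 8) at_top"
    by (intro eventually_conj eventually_ge_at_top)
  ultimately have "eventually (\<lambda>n::nat. C * real n ^ 6 \<le> 3 ^ n / 3 ^ 7 \<and> n \<ge> k \<and> n \<ge> 8) at_top"
    by eventually_elim auto
  then obtain A where A: "C * real A ^ 6 \<le> 3 ^ A / 3 ^ 7" "A \<ge> k" "A \<ge> 8"
    by (auto simp: eventually_at_top_linorder)
  moreover have "(3::real) ^ A / 3 ^ 7 = 3 ^ (A - 7)" using A by (simp add: power_diff)
  ultimately show ?thesis using that by simp
qed

lemma exp_le_two_power: "exp x \<le> 2 ^ n" if "2 * x \<le> real n" "x \<ge> 0" for x :: real and n :: nat
proof -
  have "ln 2 \<ge> (1 / 2 :: real)" using ln2_ge_two_thirds by simp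
  then have "real n * (1 / 2) \<le> real n * ln 2" by (intro mult_left_mono) auto
  then have "x \<le> real n * ln 2" using that by linarith
  then have "exp x \<le> exp (real n * ln 2)" by simp
  also have "\<dots> = 2 ^ n" by (simp add: exp_of_nat_mult)
  finally show ?thesis .
qed

lemma nat_ceiling_bounds:
  fixes x :: real
  assumes "x \<ge> 1"
  shows "x \<le> real (nat \<lceil>x\<rceil>)" "real (nat \<lceil>x\<rceil>) \<le> 2 * x"
  using assms by linarith+

text \<open>Cutting \<open>Y\<close> at \<open>K\<close> lowers the sum of \<open>psi\<close> by
  \<open>\<delta>\<close>; moving the share \<open>\<alpha> = \<delta> / D\<close> of the surplus to
  it restores the value one. The condition on \<open>K\<close> gives
  \<open>\<alpha> \<le> 1 / 2\<close>, so at least half of the surplus is left for the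
  marks.\<close>

lemma exists_critical_marking:
  fixes \<eta> :: real
  assumes m: "m \<ge> 2" and fin: "Lambda m Y < \<infinity>"
    and crit: "(real m - 1) * expec Y (\<lambda>z. real z * real m ^ z) = expec Y (\<lambda>z. real m ^ z)"
    and dom: "\<forall>k\<ge>1. pmf Y k \<le> pmf X k"
    and \<eta>: "\<eta> > 0" and r: "r \<ge> 1" and rK: "r \<le> K"
    and diff: "\<eta> / 2 \<le> (\<Sum>x=1..r. real x * (pmf X x - pmf Y x))"
    and K: "4 * (real m - 1) * enn2real (Lambda m Y) \<le> (real K)\<^sup>2 * \<eta>"
  obtains a0 where "critical_chain m r a0" "rel_pmf below a0 X"
    "\<And>y k. (y, k) \<in> set_pmf a0 \<Longrightarrow> y \<le> K"
    "tmom a0 m (\<lambda>y k. y ^ 3) \<le> 2 * real m * enn2real (Lambda m Y)"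
    "mark_mass m a0 \<ge> \<eta> / 4"
proof -
  define \<Lambda> where "\<Lambda> = enn2real (Lambda m Y)"
  define d where "d x = pmf X x - pmf Y x" for x
  have d0: "d x \<ge> 0" if "x \<ge> 1" for x using dom that by (simp add: d_def)
  define \<delta> where "\<delta> = 1 - (\<Sum>x=1..K. psi m x * pmf Y x)"
  define D where "D = (\<Sum>x=1..K. psi m x * d x)"
  note deficit = psi_deficit[OF m fin crit, of K, folded \<Lambda>_def]
  have \<delta>0: "\<delta> \<ge> 0" and \<delta>K: "(real K)\<^sup>2 * \<delta> \<le> (real m - 1) * \<Lambda>"
    using deficit(1,2) by (auto simp: \<delta>_def)
  have \<Lambda>0: "\<Lambda> \<ge> 0" by (simp add: \<Lambda>_def)
  have "(\<Sum>x=1..r. real x * d x) \<le> (\<Sum>x=1..r. psi m x * d x)"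
    using psi_ge(2)[OF m] d0 by (intro sum_mono mult_right_mono) auto
  also have "\<dots> \<le> D"
    unfolding D_def using rK psi_nonneg[OF m] d0 by (intro sum_mono2) auto
  finally have D: "\<eta> / 2 \<le> D" using diff by (simp add: d_def)
  then have D0: "D > 0" using \<eta> by linarith
  have K0: "(real K)\<^sup>2 > 0" using r rK by simp
  define \<alpha> where "\<alpha> = \<delta> / D"
  have \<alpha>0: "\<alpha> \<ge> 0" using \<delta>0 D0 by (simp add: \<alpha>_def)
  have "4 * ((real m - 1) * \<Lambda>) \<le> (real K)\<^sup>2 * \<eta>" using K by (simp only: \<Lambda>_def mult.assoc)
  then have "(real K)\<^sup>2 * (4 * \<delta>) \<le> (real K)\<^sup>2 * \<eta>" using \<delta>K by linarith
  then have "4 * \<delta> \<le> \<eta>" using K0 by (simp only: mult_le_cancel_left_pos)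
  then have \<alpha>1: "\<alpha> \<le> 1 / 2" using D D0 by (simp add: \<alpha>_def divide_le_eq)
  have \<alpha>D: "\<alpha> * D = \<delta>" using D0 by (simp add: \<alpha>_def)
  define w where "w x = pmf Y x + \<alpha> * d x" for x
  have w: "\<forall>x\<ge>1. 0 \<le> w x \<and> w x \<le> pmf X x"
  proof (intro allI impI conjI)
    fix x :: nat assume x: "x \<ge> 1"
    show "0 \<le> w x" using \<alpha>0 d0[OF x] by (simp add: w_def)
    have "\<alpha> * d x \<le> 1 * d x" using \<alpha>1 d0[OF x] by (intro mult_right_mono) auto
    then show "w x \<le> pmf X x" by (simp add: w_def d_def)
  qed
  define a0 where "a0 = split_pmf w r K X"
  have set: "set_pmf a0 \<subseteq> {..K} \<times> {..r}" unfolding a0_def by (rule set_split_pmf)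
  have "(\<Sum>x=1..K. psi m x * w x) = (\<Sum>x=1..K. psi m x * pmf Y x) + \<alpha> * D"
    by (simp add: w_def D_def algebra_simps sum.distrib sum_distrib_left)
  then have crit0: "psi_mom a0 m = 0"
    unfolding a0_def split_pmf_moments(1)[OF w] \<alpha>D \<delta>_def by simp
  have chain: "critical_chain m r a0"
  proof
    show "finite (set_pmf a0)" using set by (rule finite_subset) auto
    show "critical_law m a0" using crit0 by (simp add: critical_law_def)
  qed (use m r set in auto)
  have "tmom a0 m (\<lambda>y k. y ^ 3) = (\<Sum>x=1..K. real x ^ 3 * real m ^ x * pmf Y x)
      + \<alpha> * (\<Sum>x=1..K. real x ^ 3 * real m ^ x * d x)"
    unfolding a0_def split_pmf_moments(2)[OF w] w_def
    by (simp add: algebra_simps sum.distrib sum_distrib_left)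
  also have "\<dots> \<le> \<Lambda> + \<alpha> * (2 * (real K)\<^sup>2 * D)"
  proof (intro add_mono deficit(3) mult_left_mono \<alpha>0)
    \<comment> \<open>A unit of \<open>psi\<close> costs at most \<open>2 K^2\<close> in third
      moment. In total this is \<open>2 K^2 * \<delta>\<close>, which \<open>psi_deficit\<close>
      bounds by \<open>2 (m - 1) \<Lambda>\<close>.\<close>
    have "(\<Sum>x=1..K. real x ^ 3 * real m ^ x * d x) \<le> (\<Sum>x=1..K. 2 * (real K)\<^sup>2 * (psi m x * d x))"
    proof (rule sum_mono)
      fix x assume x: "x \<in> {1..K}"
      have "(real x)\<^sup>2 * (real x * real m ^ x) \<le> (real K)\<^sup>2 * (2 * psi m x)"
        using x psi_ge(1)[OF m, of x]
        by (intro mult_mono[of "(real x)\<^sup>2" "(real K)\<^sup>2"] power_mono) auto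
      then have "(real x)\<^sup>2 * (real x * real m ^ x) * d x \<le> (real K)\<^sup>2 * (2 * psi m x) * d x"
        using d0[of x] x by (intro mult_right_mono) auto
      then show "real x ^ 3 * real m ^ x * d x \<le> 2 * (real K)\<^sup>2 * (psi m x * d x)"
        by (simp add: power2_eq_square power3_eq_cube mult_ac)
    qed
    then show "(\<Sum>x=1..K. real x ^ 3 * real m ^ x * d x) \<le> 2 * (real K)\<^sup>2 * D"
      by (simp add: D_def sum_distrib_left)
  qed
  also have "\<alpha> * (2 * (real K)\<^sup>2 * D) = 2 * ((real K)\<^sup>2 * \<delta>)" by (simp flip: \<alpha>D)
  also have "\<Lambda> + 2 * ((real K)\<^sup>2 * \<delta>) \<le> 2 * real m * \<Lambda>" using \<delta>K \<Lambda>0 by (simp add: algebra_simps)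
  finally have third: "tmom a0 m (\<lambda>y k. y ^ 3) \<le> 2 * real m * \<Lambda>" .
  have "\<eta> / 4 \<le> (1 - \<alpha>) * (\<Sum>x=1..r. real x * d x)"
    using mult_mono[of "1 / 2" "1 - \<alpha>" "\<eta> / 2" "\<Sum>x=1..r. real x * d x"] \<alpha>1 diff \<eta>
    by (simp add: d_def)
  also have "\<dots> = (\<Sum>x=1..r. real (min x r) * (pmf X x - w x))"
    unfolding sum_distrib_left by (intro sum.cong) (auto simp: w_def d_def algebra_simps)
  also have "\<dots> \<le> (\<Sum>x=1..K. real (min x r) * (pmf X x - w x))"
    using rK w by (intro sum_mono2) auto
  also have "\<dots> = mark_mass m a0" unfolding a0_def split_pmf_moments(3)[OF w] ..
  finally have mark: "\<eta> / 4 \<le> mark_mass m a0" .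
  have rel: "rel_pmf below a0 X" unfolding a0_def by (rule rel_split_pmf)
  show ?thesis
    using that[OF chain rel _ third[unfolded \<Lambda>_def] mark] set by auto
qed

section \<open>Time until the mean reaches two\<close>

text \<open>Take the first time at which \<open>P\<close> reaches \<open>\<Theta>\<close>; a single
  step multiplies \<open>P\<close> by at most \<open>(2 m^2)^(m - 1)\<close>.\<close>

lemma (in critical_chain) exists_hitting_time:
  assumes "\<nu>\<^sup>2 \<ge> Kap * \<Theta>" "\<Theta> \<ge> 1" "real N \<ge> \<nu>" "\<nu> \<ge> 0"
  obtains n where "n \<le> 2 * N" "P n \<ge> \<Theta>" "P n \<le> (2 * (real m)\<^sup>2) ^ (m - 1) * \<Theta>"
proof -
  define n where "n = (LEAST n. P n \<ge> \<Theta>)"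
  have "Kap * \<Theta> \<le> (real N)\<^sup>2" using assms power_mono[of \<nu> "real N" 2] by linarith
  then have "Kap * \<Theta> \<le> Kap * P (2 * N)" using P_quadratic[of N] by linarith
  then have PN: "P (2 * N) \<ge> \<Theta>" using Kap_pos by simp
  have n: "P n \<ge> \<Theta>" unfolding n_def by (rule LeastI[of _ "2 * N"]) (fact PN)
  have nN: "n \<le> 2 * N" unfolding n_def by (rule Least_le) (fact PN)
  have "1 \<le> (real m)\<^sup>2" using m2 by (intro one_le_power) auto
  then have M: "2 * (real m)\<^sup>2 \<ge> 1" by linarith
  have "P n \<le> (2 * (real m)\<^sup>2) ^ (m - 1) * \<Theta>"
  proof (cases n)
    case 0
    have "1 * 1 \<le> (2 * (real m)\<^sup>2) ^ (m - 1) * \<Theta>"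
      using assms(2) M by (intro mult_mono one_le_power) auto
    then show ?thesis by (simp add: 0)
  next
    case (Suc l)
    have "P l < \<Theta>" using not_less_Least[of l "\<lambda>n. P n \<ge> \<Theta>"] Suc by (simp add: n_def)
    then have "P l * G l ^ (m - 1) \<le> \<Theta> * (2 * (real m)\<^sup>2) ^ (m - 1)"
      using G_le[of l] G_ge_1[of l] P_pos[of l] by (intro mult_mono power_mono) auto
    then show ?thesis by (simp add: Suc P_Suc mult.commute)
  qed
  with n nN that show ?thesis by blast
qed

lemma mean_reaches_two:
  assumes m: "m \<ge> 2"
  obtains C :: real where "C > 0"
    "\<And>X Y \<eta> R. Lambda m Y < \<infinity> \<Longrightarrow>
      (real m - 1) * expec Y (\<lambda>z. real z * real m ^ z) = expec Y (\<lambda>z. real m ^ z) \<Longrightarrow>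
      \<forall>k\<ge>1. pmf Y k \<le> pmf X k \<Longrightarrow> 0 < \<eta> \<Longrightarrow> \<eta> \<le> 1 \<Longrightarrow> Enat Y + ennreal \<eta> \<le> Enat X \<Longrightarrow>
      R \<ge> 3 \<Longrightarrow> enn2real (Lambda m Y) \<le> R * \<eta> \<Longrightarrow>
      \<exists>j. real j \<le> C * (sqrt (R * ln R) * ln R) \<and> Enat (rs m X j) \<ge> 2"
proof -
  define M where "M = real m"
  have M2: "M \<ge> 2" using m by (simp add: M_def)
  define g where "g = (2 * M\<^sup>2) ^ (m - 1)"
  define C2 where "C2 = exp 6 * (3 * M + 16 * M\<^sup>2 * (M - 1) ^ 3)"
  have "1 \<le> M\<^sup>2" using M2 by (intro one_le_power) auto
  then have g1: "g \<ge> 1" unfolding g_def by (intro one_le_power) auto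
  have "1 * 1 \<le> exp 6 * (3 * M + 16 * M\<^sup>2 * (M - 1) ^ 3)"
    using M2 by (intro mult_mono add_increasing2) auto
  then have C21: "C2 \<ge> 1" by (simp add: C2_def)
  \<comment> \<open>With \<open>\<epsilon> = 1 / (c3 * A * Z)\<close> this cancels the bound
    \<open>264 * M ^ 3 * A * Z\<^sup>2\<close> on \<open>Lam * \<Theta>\<close> together with
    \<open>g * C2\<close> in the smallness condition of \<open>Psi_le_2\<close>.\<close>
  define c3 where "c3 = 264 * M ^ 3 * g * C2"
  have M3: "M ^ 3 \<ge> 1" using M2 by (intro one_le_power) auto
  have gC: "1 \<le> g * C2" using mult_mono[OF g1 C21] g1 by simp
  have c3_ge: "264 * M ^ 3 \<le> c3"
    using mult_left_mono[OF gC, of "264 * M ^ 3"] M2 by (simp add: c3_def mult.assoc)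
  then have c31: "c3 \<ge> 264" using M3 by linarith
  \<comment> \<open>\<open>R ^ A'\<close> has to beat all polynomial losses;
    \<open>785664 = 8 * 4 * 132 * 186\<close> gathers the constants met in the final
    estimate.\<close>
  obtain A' :: nat where A': "A' \<ge> m" "A' \<ge> 8" "785664 * M ^ 7 * c3\<^sup>2 * real A' ^ 6 \<le> 3 ^ (A' - 7)"
    using exists_exponent[of "785664 * M ^ 7 * c3\<^sup>2" m] M2 c31 by auto
  define A where "A = real A'"
  have A8: "A \<ge> 8" and AM: "A \<ge> M" using A' by (auto simp: A_def M_def)
  \<comment> \<open>The three terms pay for the time \<open>n\<close>, the height \<open>T\<close>
    and the cap \<open>r\<close>, whose sum is the time horizon.\<close>
  define C where "C = 132 * M ^ 3 * A + 4 * c3 * A\<^sup>2 + 4 * A"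
  have "C > 0" unfolding C_def using M2 A8 c31 by (intro add_pos_pos mult_pos_pos) auto
  moreover have "\<exists>j. real j \<le> C * (sqrt (R * ln R) * ln R) \<and> Enat (rs m X j) \<ge> 2"
    if fin: "Lambda m Y < \<infinity>"
      and crit: "(real m - 1) * expec Y (\<lambda>z. real z * real m ^ z) = expec Y (\<lambda>z. real m ^ z)"
      and dom: "\<forall>k\<ge>1. pmf Y k \<le> pmf X k" and \<eta>: "0 < \<eta>" "\<eta> \<le> 1"
      and EX: "Enat Y + ennreal \<eta> \<le> Enat X" and R3: "R \<ge> 3"
      and LR: "enn2real (Lambda m Y) \<le> R * \<eta>"
    for X Y \<eta> R
  proof (rule ccontr)
    assume contra: "\<not> ?thesis"
    define \<Lambda> where "\<Lambda> = enn2real (Lambda m Y)"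
    define L where "L = ln R"
    define Z where "Z = sqrt (R * L)"
    have "exp 1 < (3::real)" using e_less_272 by simp
    then have "exp 1 \<le> R" using R3 by linarith
    then have L1: "L \<ge> 1" using R3 by (simp add: L_def ln_ge_iff)
    have LleR: "L \<le> R" using R3 ln_le_minus_one[of R] by (simp add: L_def)
    have Z2: "Z\<^sup>2 = R * L" using R3 L1 by (simp add: Z_def)
    have Z0: "Z \<ge> 0" using R3 L1 by (simp add: Z_def)
    have LZ: "L \<le> Z"
    proof (rule power2_le_imp_le)
      show "L\<^sup>2 \<le> Z\<^sup>2" unfolding Z2 unfolding power2_eq_square using LleR L1 by (intro mult_right_mono) auto
    qed (fact Z0)
    have ZR: "Z \<le> R"
    proof (rule power2_le_imp_le)
      show "Z\<^sup>2 \<le> R\<^sup>2" unfolding Z2 unfolding power2_eq_square using LleR R3 by (intro mult_left_mono) auto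
    qed (use R3 in simp)
    have Z1: "Z \<ge> 1" using LZ L1 by linarith
    \<comment> \<open>A lower bound for \<open>\<eta>\<close>, so that dividing by
      \<open>\<eta>\<close> costs only one more power of \<open>R\<close>.\<close>
    have R\<eta>: "1 \<le> M * R * \<eta>"
    proof -
      have "1 \<le> (M - 1) * \<Lambda>" using Lambda_ge[OF m fin crit] by (simp add: M_def \<Lambda>_def)
      also have "\<dots> \<le> M * (R * \<eta>)" using LR M2 by (intro mult_mono) (auto simp: \<Lambda>_def)
      finally show ?thesis by simp
    qed
    have less: "Enat (rs m X j) < 2" if "real j \<le> C * (Z * L)" for j
      using contra that unfolding Z_def L_def by (meson not_le)
    define t0 where "t0 = nat \<lceil>A * L\<rceil>"
    have AL: "A * L \<ge> 8" using mult_mono[of 8 A 1 L] A8 L1 by simp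
    have t0: "A * L \<le> real t0" "real t0 \<le> 2 * (A * L)"
      unfolding t0_def using AL by (intro nat_ceiling_bounds; simp)+
    \<comment> \<open>The surplus is localised below \<open>2 * t0\<close>, so with this cap its
      marks are not cut at the start.\<close>
    define r where "r = 2 * t0"
    have rr: "real r = 2 * real t0" by (simp add: r_def)
    have r_ge: "2 * (A * L) \<le> real r" and r_le: "real r \<le> 4 * (A * L)" using t0 rr by linarith+
    have r1: "r \<ge> 1" using r_ge AL by linarith
    define E where "E = exp (A * L)"
    have ER: "E = R ^ A'" using R3 by (simp add: E_def A_def L_def exp_of_nat_mult)
    have E_big: "785664 * M ^ 7 * c3\<^sup>2 * A ^ 6 * R ^ 7 \<le> E"
    proof -
      have "785664 * M ^ 7 * c3\<^sup>2 * A ^ 6 * R ^ 7 \<le> 3 ^ (A' - 7) * R ^ 7"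
        using A'(3) R3 by (intro mult_right_mono) (auto simp: A_def)
      also have "\<dots> \<le> R ^ (A' - 7) * R ^ 7"
        using R3 by (intro mult_right_mono power_mono) auto
      also have "\<dots> = E" using A'(2) unfolding ER by (simp flip: power_add)
      finally show ?thesis .
    qed
    have E0: "E > 0" by (simp add: E_def)
    have mr: "E \<le> M ^ r"
    proof -
      have "E \<le> 2 ^ r" unfolding E_def using r_ge AL by (intro exp_le_two_power) auto
      also have "\<dots> \<le> M ^ r" using M2 by (intro power_mono) auto
      finally show ?thesis .
    qed
    have c3A: "1 \<le> c3\<^sup>2 * A ^ 6" using c31 A8 mult_mono[of 1 "c3\<^sup>2" 1 "A ^ 6"] by (simp add: one_le_power)
    have J_le: "132 * M ^ 3 * A * Z + 4 * c3 * A\<^sup>2 * L * Z + 4 * (A * L) \<le> C * (Z * L)"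
    proof -
      have "132 * M ^ 3 * A * Z * 1 \<le> 132 * M ^ 3 * A * Z * L"
        using M2 A8 Z0 L1 by (intro mult_left_mono) auto
      moreover have "4 * (A * L) * 1 \<le> 4 * (A * L) * Z"
        using A8 L1 Z1 by (intro mult_left_mono) auto
      ultimately show ?thesis unfolding C_def by (simp add: algebra_simps)
    qed
    have nn: "132 * M ^ 3 * A * Z \<ge> 0" "4 * c3 * A\<^sup>2 * L * Z \<ge> 0"
      using M2 A8 Z0 c31 L1 by auto
    \<comment> \<open>Otherwise the mean at time \<open>t0\<close> would be at least
      \<open>m ^ t0 * \<eta> / 8\<close>, which exceeds \<open>2\<close> by the choice of
      \<open>A\<close>.\<close>
    have ex: "excess t0 X \<le> ennreal (\<eta> / 8)"
    proof (rule ccontr)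
      assume "\<not> ?thesis"
      then have "of_nat m ^ t0 * ennreal (\<eta> / 8) \<le> of_nat m ^ t0 * excess t0 (rs m X 0)"
        by (intro mult_left_mono) auto
      also have "\<dots> \<le> Enat (rs m X (0 + t0))" by (rule Enat_rs_ge)
      also have "\<dots> < 2"
      proof (rule less)
        show "real (0 + t0) \<le> C * (Z * L)" using t0 J_le nn AL by linarith
      qed
      also have "of_nat m ^ t0 * ennreal (\<eta> / 8) = ennreal (M ^ t0 * (\<eta> / 8))"
        using \<eta> by (subst ennreal_mult) (auto simp: M_def ennreal_of_nat_eq_real_of_nat ennreal_power)
      finally have "ennreal (M ^ t0 * (\<eta> / 8)) < ennreal 2" by simp
      then have lt: "M ^ t0 * (\<eta> / 8) < 2" by (subst (asm) ennreal_less_iff) (use \<eta> M2 in auto)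
      have "16 * M * R \<le> M ^ t0"
      proof (rule power2_le_imp_le)
        have "(16 * M * R)\<^sup>2 = 256 * M\<^sup>2 * R\<^sup>2" by (simp add: power_mult_distrib)
        also have "\<dots> \<le> (785664 * M ^ 7) * R ^ 7"
          using M2 R3 by (intro mult_mono power_increasing) auto
        also have "\<dots> \<le> (785664 * M ^ 7) * R ^ 7 * (c3\<^sup>2 * A ^ 6)"
          using mult_left_mono[OF c3A, of "(785664 * M ^ 7) * R ^ 7"] M2 R3 by simp
        also have "\<dots> = 785664 * M ^ 7 * c3\<^sup>2 * A ^ 6 * R ^ 7" by simp
        also have "\<dots> \<le> M ^ r" using E_big mr by linarith
        also have "\<dots> = (M ^ t0)\<^sup>2" by (simp add: r_def power_mult mult.commute flip: power_mult)
        finally show "(16 * M * R)\<^sup>2 \<le> (M ^ t0)\<^sup>2" .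
      qed (use M2 in simp)
      then have "16 * M * R * (\<eta> / 8) \<le> M ^ t0 * (\<eta> / 8)"
        using \<eta> by (intro mult_right_mono) auto
      then have "2 * (M * R * \<eta>) < 2" using lt by simp
      with R\<eta> show False by linarith
    qed
    have diff: "\<eta> / 2 \<le> (\<Sum>x=1..r. real x * (pmf X x - pmf Y x))"
      unfolding r_def by (rule sum_mean_difference[OF EX \<eta>(1) ex])
    \<comment> \<open>Large enough for criticality to be restored cheaply, yet of order
      \<open>Z\<close>, so that \<open>\<epsilon> * K \<le> 1\<close>.\<close>
    define K where "K = nat \<lceil>4 * A * Z\<rceil>"
    have AZ: "4 * A * Z \<ge> 1" using mult_mono[of 1 "4 * A" 1 Z] A8 Z1 by simp
    have K: "4 * A * Z \<le> real K" "real K \<le> 2 * (4 * A * Z)"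
      unfolding K_def using AZ by (intro nat_ceiling_bounds; simp)+
    have "A * L \<le> A * Z" using LZ A8 by (intro mult_left_mono) auto
    then have "real r \<le> real K" using r_le K(1) by linarith
    then have rK: "r \<le> K" by simp
    have K2: "4 * (real m - 1) * enn2real (Lambda m Y) \<le> (real K)\<^sup>2 * \<eta>"
    proof -
      have "4 * (M - 1) * \<Lambda> \<le> (16 * A\<^sup>2) * (R * \<eta> * L)"
      proof (rule mult_mono)
        have "A \<le> A\<^sup>2" using A8 by (intro self_le_power) auto
        then show "4 * (M - 1) \<le> 16 * A\<^sup>2" using AM A8 by (smt (verit))
        have "R * \<eta> * 1 \<le> R * \<eta> * L" using L1 R3 \<eta> by (intro mult_left_mono) auto
        then show "\<Lambda> \<le> R * \<eta> * L" using LR by (simp add: \<Lambda>_def)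
      qed (auto simp: \<Lambda>_def)
      also have "\<dots> = (4 * A * Z)\<^sup>2 * \<eta>" by (simp add: power_mult_distrib Z2)
      also have "\<dots> \<le> (real K)\<^sup>2 * \<eta>" using K(1) A8 Z0 \<eta> by (intro mult_right_mono power_mono) auto
      finally show ?thesis by (simp add: M_def \<Lambda>_def)
    qed
    obtain a0 where a0: "critical_chain m r a0" "rel_pmf below a0 X"
      "\<And>y k. (y, k) \<in> set_pmf a0 \<Longrightarrow> y \<le> K"
      "tmom a0 m (\<lambda>y k. y ^ 3) \<le> 2 * real m * enn2real (Lambda m Y)" "mark_mass m a0 \<ge> \<eta> / 4"
      using exists_critical_marking[OF m fin crit dom \<eta>(1) r1 rK diff K2] by blast
    interpret critical_chain m r a0 by (rule a0(1))
    have Lam: "Lam \<le> 2 * M * (R * \<eta>)"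
    proof -
      have "2 * M * \<Lambda> \<le> 2 * M * (R * \<eta>)" using LR M2 by (intro mult_left_mono) (auto simp: \<Lambda>_def)
      then show ?thesis using a0(4) by (simp add: Lam_def M_def \<Lambda>_def)
    qed
    \<comment> \<open>Any constant above \<open>32\<close> would do:
      \<open>\<Theta> * (\<eta> / 8)\<close> must exceed the upper bound
      \<open>4 * M\<^sup>2 * r\<close> on the mark mass.\<close>
    define \<Theta> where "\<Theta> = 33 * M\<^sup>2 * r / \<eta>"
    have \<Theta>_le: "\<Theta> \<le> 132 * M\<^sup>2 * A * L / \<eta>"
    proof -
      have "33 * M\<^sup>2 * real r \<le> 33 * M\<^sup>2 * (4 * (A * L))" using r_le by (intro mult_left_mono) auto
      then show ?thesis unfolding \<Theta>_def using \<eta> by (intro divide_right_mono) auto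
    qed
    have \<Theta>1: "\<Theta> \<ge> 1"
    proof -
      have "1 \<le> 33 * M\<^sup>2" using \<open>1 \<le> M\<^sup>2\<close> by linarith
      then have "1 * 1 \<le> (33 * M\<^sup>2) * real r" using r1 by (intro mult_mono) auto
      then show ?thesis unfolding \<Theta>_def using \<eta> by (simp add: le_divide_eq)
    qed
    have LamTh: "Lam * \<Theta> \<le> 264 * M ^ 3 * A * Z\<^sup>2"
    proof -
      have "Lam * \<Theta> \<le> (2 * M * (R * \<eta>)) * (132 * M\<^sup>2 * A * L / \<eta>)"
        using Lam \<Theta>_le Lam_pos \<Theta>1 M2 R3 \<eta> by (intro mult_mono) auto
      also have "\<dots> = 264 * M ^ 3 * A * Z\<^sup>2"
        unfolding Z2 using \<eta> by (simp add: power2_eq_square power3_eq_cube)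
      finally show ?thesis .
    qed
    \<comment> \<open>Chosen with \<open>\<nu>\<^sup>2 \<ge> Kap * \<Theta>\<close>. The hitting
      time is then at most \<open>4 * \<nu>\<close>, the first term of the horizon.\<close>
    define \<nu> where "\<nu> = 33 * M ^ 3 * A * Z"
    have \<nu>1: "\<nu> \<ge> 1"
    proof -
      have "1 * 1 * 1 * 1 \<le> 33 * M ^ 3 * A * Z" using M3 M2 A8 Z1 by (intro mult_mono) auto
      then show ?thesis by (simp add: \<nu>_def)
    qed
    have KapTh: "Kap * \<Theta> \<le> \<nu>\<^sup>2"
    proof -
      have "Kap * \<Theta> = 4 * (M - 1) ^ 3 * (Lam * \<Theta>)" by (simp add: Kap_def M_def)
      also have "\<dots> \<le> 4 * M ^ 3 * (264 * M ^ 3 * A * Z\<^sup>2)"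
        using LamTh M2 Lam_pos \<Theta>1
        by (intro mult_mono[of "4 * (M - 1) ^ 3" _ "Lam * \<Theta>"] mult_left_mono power_mono) auto
      also have "\<dots> = 1056 * M ^ 6 * Z\<^sup>2 * A" by (simp flip: power_add)
      also have "\<dots> \<le> 1089 * M ^ 6 * Z\<^sup>2 * A\<^sup>2"
        using A8 M2 by (intro mult_mono self_le_power) auto
      also have "\<dots> = \<nu>\<^sup>2" by (simp add: \<nu>_def power_mult_distrib flip: power_mult)
      finally show ?thesis .
    qed
    obtain n where n: "n \<le> 2 * nat \<lceil>\<nu>\<rceil>" "P n \<ge> \<Theta>" "P n \<le> g * \<Theta>"
      using exists_hitting_time[OF KapTh \<Theta>1 nat_ceiling_bounds(1)[OF \<nu>1]] \<nu>1
      by (auto simp: g_def M_def)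
    have "real n \<le> 2 * real (nat \<lceil>\<nu>\<rceil>)" using n(1) by linarith
    then have n_le: "real n \<le> 132 * M ^ 3 * A * Z"
      using nat_ceiling_bounds(2)[OF \<nu>1] by (simp add: \<nu>_def)
    define \<epsilon> where "\<epsilon> = 1 / (c3 * A * Z)"
    have c3AZ: "264 * M ^ 3 * A * Z \<le> c3 * A * Z" "8 * A * Z \<le> c3 * A * Z" "c3 * A * Z \<ge> 2"
    proof -
      show "264 * M ^ 3 * A * Z \<le> c3 * A * Z" using c3_ge A8 Z0 by (intro mult_right_mono) auto
      show "8 * A * Z \<le> c3 * A * Z" using c31 A8 Z0 by (intro mult_right_mono) auto
      have "2 * 1 * 1 \<le> c3 * A * Z" using c31 A8 Z1 by (intro mult_mono) auto
      then show "c3 * A * Z \<ge> 2" by simp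
    qed
    have \<epsilon>: "0 < \<epsilon>" "\<epsilon> \<le> 1 / 2" using c3AZ(3) by (auto simp: \<epsilon>_def field_simps)
    have \<epsilon>K: "\<epsilon> * real y \<le> 1" if "(y, k) \<in> set_pmf a0" for y k
    proof -
      have "real y \<le> c3 * A * Z" using a0(3)[OF that] K(2) c3AZ(2) by linarith
      then show ?thesis using c3AZ(3) by (simp add: \<epsilon>_def divide_le_eq)
    qed
    have n\<epsilon>: "real n * \<epsilon> \<le> 1"
    proof -
      have "132 * M ^ 3 * A * Z \<le> 264 * M ^ 3 * A * Z" using M2 A8 Z0 by (intro mult_right_mono) auto
      then show ?thesis using n_le c3AZ by (simp add: \<epsilon>_def divide_le_eq)
    qed
    have cond: "\<epsilon>\<^sup>2 * Lam * (g * \<Theta>) * C2 \<le> 1"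
    proof -
      have "\<epsilon>\<^sup>2 * Lam * (g * \<Theta>) * C2 = \<epsilon>\<^sup>2 * (g * C2) * (Lam * \<Theta>)" by simp
      also have "\<dots> \<le> \<epsilon>\<^sup>2 * (g * C2) * (264 * M ^ 3 * A * Z\<^sup>2)"
        using LamTh gC by (intro mult_left_mono) auto
      also have "\<dots> = \<epsilon>\<^sup>2 * (c3 * A * Z\<^sup>2)" by (simp add: c3_def)
      also have "\<dots> = 1 / (c3 * A)"
        using c31 A8 Z1 by (simp add: \<epsilon>_def power2_eq_square)
      also have "\<dots> \<le> 1"
        using mult_mono[of 1 c3 1 A] c31 A8 by simp
      finally show ?thesis .
    qed
    have Psi2: "Psi \<epsilon> k \<le> 2" if "k \<le> n" for k
      using Psi_le_2[OF \<epsilon> \<epsilon>K n\<epsilon> n(3) _ that] cond by (simp add: C2_def M_def)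
    \<comment> \<open>Because \<open>ln (1 + \<epsilon>) \<ge> \<epsilon> / 2\<close>, this height
      makes \<open>(1 + \<epsilon>) ^ T\<close> at least \<open>E\<close>.\<close>
    define T where "T = nat \<lceil>2 * (A * L) / \<epsilon>\<rceil>"
    have ALe: "2 * (A * L) / \<epsilon> \<ge> 1" using AL \<epsilon> by (simp add: le_divide_eq)
    have T_le: "real T \<le> 4 * c3 * A\<^sup>2 * L * Z"
      unfolding T_def using nat_ceiling_bounds(2)[OF ALe] by (simp add: \<epsilon>_def power2_eq_square mult_ac)
    have T_E: "E \<le> (1 + \<epsilon>) ^ T"
    proof -
      have "\<epsilon> * \<epsilon> \<le> \<epsilon> * (1 / 2)" using \<epsilon> by (intro mult_left_mono) auto
      then have "\<epsilon> / 2 \<le> \<epsilon> - \<epsilon>\<^sup>2" by (simp add: power2_eq_square)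
      also have "\<dots> \<le> ln (1 + \<epsilon>)" using \<epsilon> by (intro ln_one_plus_pos_lower_bound) auto
      finally have "real T * (\<epsilon> / 2) \<le> real T * ln (1 + \<epsilon>)" by (intro mult_left_mono) auto
      moreover have "2 * (A * L) \<le> real T * \<epsilon>"
        using nat_ceiling_bounds(1)[OF ALe] \<epsilon> by (simp add: T_def divide_le_eq)
      ultimately have "A * L \<le> real T * ln (1 + \<epsilon>)" by linarith
      then have "E \<le> exp (real T * ln (1 + \<epsilon>))" by (simp add: E_def)
      also have "\<dots> = (1 + \<epsilon>) ^ T" using \<epsilon> by (simp add: exp_of_nat_mult)
      finally show ?thesis .
    qed
    \<comment> \<open>The constant is \<open>24 + 162\<close>, from the tail term and the term with
      full marks in \<open>full_mass_le\<close>.\<close>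
    define q where "q = 186 * M\<^sup>2 * c3\<^sup>2 * A ^ 4 * R ^ 4 / E"
    have TrR: "real T + real r + 1 \<le> 9 * c3 * A\<^sup>2 * R\<^sup>2"
    proof -
      have B: "c3 * A\<^sup>2 * R\<^sup>2 \<ge> 0" using c31 by simp
      have "c3 * A\<^sup>2 * (L * Z) \<le> c3 * A\<^sup>2 * (R * R)"
        using c31 LleR ZR R3 L1 Z0 by (intro mult_left_mono mult_mono) auto
      then have 1: "real T \<le> 4 * (c3 * A\<^sup>2 * R\<^sup>2)" using T_le by (simp add: power2_eq_square mult_ac)
      have "1 * A * L \<le> c3 * A\<^sup>2 * R\<^sup>2"
        using c31 A8 LleR R3 L1 self_le_power[of A 2] self_le_power[of R 2]
        by (intro mult_mono) (auto intro: order_trans)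
      then have 2: "real r \<le> 4 * (c3 * A\<^sup>2 * R\<^sup>2)" using r_le by simp
      have "1 * 1 * 1 \<le> c3 * A\<^sup>2 * R\<^sup>2"
        using c31 A8 R3 by (intro mult_mono one_le_power) auto
      then show ?thesis using 1 2 by simp
    qed
    have full: "full_mass m r (chain k) \<le> q" if "k \<le> n" for k
    proof -
      have J: "Enat (rs m X (k + t)) < 2" if "t \<le> T + r" for t
      proof (rule less)
        have "real (k + t) \<le> real n + (real T + real r)" using that \<open>k \<le> n\<close> by linarith
        then show "real (k + t) \<le> C * (Z * L)" using n_le T_le r_le J_le by linarith
      qed
      have "full_mass m r (chain k) \<le> tmom (chain k) m (\<lambda>y j. (y + 1) * of_bool (y > real T))
          + 2 * real m * (real T + 1) * (real T + real r + 1) / real m ^ r"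
        by (rule full_mass_le[OF a0(2) J])
      also have "\<dots> \<le> (8 + 16 * (real m)\<^sup>2) / (1 + \<epsilon>) ^ T
          + 2 * real m * (real T + 1) * (real T + real r + 1) / real m ^ r"
        using tail_le[OF \<epsilon> Psi2[OF that], of T] by simp
      also have "\<dots> \<le> (8 + 16 * M\<^sup>2) / E + 2 * M * (real T + 1) * (real T + real r + 1) / E"
        using T_E mr E0 M2 unfolding M_def by (intro add_mono divide_left_mono mult_pos_pos) auto
      also have "\<dots> = ((8 + 16 * M\<^sup>2) + 2 * M * (real T + 1) * (real T + real r + 1)) / E"
        by (simp add: add_divide_distrib)
      also have "\<dots> \<le> (186 * M\<^sup>2 * c3\<^sup>2 * A ^ 4 * R ^ 4) / E"
      proof (rule divide_right_mono)
        define W where "W = c3 * A\<^sup>2 * R\<^sup>2"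
        have "1 * 1 * 1 \<le> W" unfolding W_def using c31 A8 R3 by (intro mult_mono one_le_power) auto
        then have W1: "W \<ge> 1" by simp
        have "2 * M * (real T + 1) * (real T + real r + 1) \<le> 2 * M * (9 * W) * (9 * W)"
          using TrR M2 W1 unfolding W_def by (intro mult_mono) auto
        also have "\<dots> = 162 * W\<^sup>2 * M" by (simp add: power2_eq_square)
        also have "\<dots> \<le> 162 * W\<^sup>2 * M\<^sup>2"
          using M2 by (intro mult_left_mono self_le_power) auto
        finally have 1: "2 * M * (real T + 1) * (real T + real r + 1) \<le> 162 * (M\<^sup>2 * W\<^sup>2)" by simp
        have "M\<^sup>2 * 1 \<le> M\<^sup>2 * W\<^sup>2" using W1 by (intro mult_left_mono one_le_power) auto
        then have 2: "8 + 16 * M\<^sup>2 \<le> 24 * (M\<^sup>2 * W\<^sup>2)" using \<open>1 \<le> M\<^sup>2\<close> by linarith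
        have "M\<^sup>2 * W\<^sup>2 * 186 = 186 * M\<^sup>2 * c3\<^sup>2 * A ^ 4 * R ^ 4"
          by (simp add: W_def power_mult_distrib flip: power_mult)
        then show "8 + 16 * M\<^sup>2 + 2 * M * (real T + 1) * (real T + real r + 1) \<le>
            186 * M\<^sup>2 * c3\<^sup>2 * A ^ 4 * R ^ 4"
          using 1 2 by linarith
      qed (use E0 in simp)
      finally show ?thesis by (simp add: q_def)
    qed
    have q0: "q \<ge> 0" using E0 R3 A8 by (simp add: q_def)
    \<comment> \<open>The product \<open>r * n\<close> costs two powers of \<open>R\<close>,
      \<open>q\<close> four and \<open>1 / \<eta>\<close> one: these are the seven powers beaten by
      \<open>E\<close>.\<close>
    have small: "(real m - 1) * r * n * q \<le> \<eta> / 8"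
    proof -
      have "(real m - 1) * real r * real n \<le> M * (4 * (A * R)) * (132 * M ^ 3 * A * R)"
      proof (intro mult_mono)
        have "A * L \<le> A * R" using LleR A8 by (intro mult_left_mono) auto
        then show "real r \<le> 4 * (A * R)" using r_le by linarith
        have "132 * M ^ 3 * A * Z \<le> 132 * M ^ 3 * A * R"
          using ZR M2 A8 by (intro mult_left_mono) auto
        then show "real n \<le> 132 * M ^ 3 * A * R" using n_le by linarith
      qed (use M2 A8 R3 in \<open>auto simp: M_def\<close>)
      then have "(real m - 1) * r * n * q \<le> M * (4 * (A * R)) * (132 * M ^ 3 * A * R) * q"
        using q0 by (intro mult_right_mono) auto
      also have "\<dots> = 98208 * M ^ 6 * c3\<^sup>2 * A ^ 6 * R ^ 6 / E"
        by (simp add: q_def field_simps) (simp add: algebra_simps eval_nat_numeral)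
      also have "\<dots> \<le> \<eta> / 8"
      proof -
        have "98208 * M ^ 6 * c3\<^sup>2 * A ^ 6 * R ^ 6 * 1 \<le> 98208 * M ^ 6 * c3\<^sup>2 * A ^ 6 * R ^ 6 * (M * R * \<eta>)"
          using R\<eta> M2 A8 R3 by (intro mult_left_mono) auto
        also have "\<dots> = (785664 * M ^ 7 * c3\<^sup>2 * A ^ 6 * R ^ 7) * (\<eta> / 8)"
          by (simp add: algebra_simps eval_nat_numeral)
        also have "\<dots> \<le> E * (\<eta> / 8)" using E_big \<eta> by (intro mult_right_mono) auto
        finally show ?thesis using E0 by (simp add: divide_le_eq mult.commute)
      qed
      finally show ?thesis .
    qed
    have "\<Theta> * (\<eta> / 8) \<le> P n * (mark_mass m a0 - (real m - 1) * r * n * q)"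
      using n(2) small a0(5) \<Theta>1 \<eta> by (intro mult_mono) auto
    also have "\<dots> \<le> mark_mass m (chain n)"
      using full q0 by (intro mark_mass_chain_ge) auto
    also have "\<dots> \<le> 4 * M\<^sup>2 * r" unfolding M_def by (rule mark_mass_chain_le)
    also have "\<Theta> * (\<eta> / 8) = 33 / 8 * (M\<^sup>2 * r)" using \<eta> by (simp add: \<Theta>_def)
    finally have "33 / 8 * (M\<^sup>2 * r) \<le> 4 * (M\<^sup>2 * r)" by simp
    moreover have "M\<^sup>2 * r > 0" using M2 r1 by simp
    ultimately show False by linarith
  qed
  ultimately show thesis using that by blast
qed

theorem theorem6p5:
  fixes m :: nat and \<beta> :: real
  assumes "m \<ge> 2" and "0 \<le> \<beta>" and "\<beta> \<le> 2"
  shows "\<exists>c40 > 0. \<exists>c41 > 0. \<forall>(chi::real) (Y0::nat pmf) (X0::nat pmf) (\<eta>::real).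
    0 < chi \<longrightarrow> chi \<le> 1 \<longrightarrow>
    measure_pmf.prob Y0 {2..} > 0 \<longrightarrow>
    Lambda m Y0 < \<infinity> \<longrightarrow>
    (real m - 1) * measure_pmf.expectation Y0 (\<lambda>z. real z * real m ^ z)
       = measure_pmf.expectation Y0 (\<lambda>z. real m ^ z) \<longrightarrow>
    regular m \<beta> chi Y0 \<longrightarrow>
    (\<forall>k::nat. k \<ge> 1 \<longrightarrow> pmf X0 k \<ge> pmf Y0 k) \<longrightarrow>
    0 < \<eta> \<longrightarrow> \<eta> \<le> 1 / (3 * (real m - 1)) \<longrightarrow>
    Enat X0 \<ge> Enat Y0 + ennreal \<eta> \<longrightarrow>
    (let \<Lambda> = enn2real (Lambda m Y0);
         R = \<Lambda> / (\<eta> * chi * pmf Y0 0);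
         M = max (\<Lambda> * (R * ln R) powr ((1 - \<beta>) / 2)) ((R * ln R) powr (1 / 2)) * ln R
                / sqrt (chi ^ 3 * pmf Y0 0);
         n0 = nat \<lfloor>c40 * M\<rfloor>
     in (\<exists>j \<le> n0. Enat (rs m X0 j) \<ge> 2) \<and>
        free_energy m X0 \<ge> ennreal (exp (- c41 * M)))"
proof -
  note m = \<open>m \<ge> 2\<close>
  obtain C where C: "C > 0" "\<And>X Y \<eta> R. Lambda m Y < \<infinity> \<Longrightarrow>
      (real m - 1) * expec Y (\<lambda>z. real z * real m ^ z) = expec Y (\<lambda>z. real m ^ z) \<Longrightarrow>
      \<forall>k\<ge>1. pmf Y k \<le> pmf X k \<Longrightarrow> 0 < \<eta> \<Longrightarrow> \<eta> \<le> 1 \<Longrightarrow> Enat Y + ennreal \<eta> \<le> Enat X \<Longrightarrow>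
      R \<ge> 3 \<Longrightarrow> enn2real (Lambda m Y) \<le> R * \<eta> \<Longrightarrow>
      \<exists>j. real j \<le> C * (sqrt (R * ln R) * ln R) \<and> Enat (rs m X j) \<ge> 2"
    using mean_reaches_two[OF m] by blast
  have lnm: "ln (real m) > 0" using m by simp
  \<comment> \<open>\<open>c41 = C * ln m\<close> because \<open>free_energy_ge\<close> yields
    \<open>m^(-j) = exp (- j * ln m)\<close>.\<close>
  show ?thesis
  proof (rule exI[of _ C], rule conjI, fact C(1), rule exI[of _ "C * ln (real m)"], intro conjI allI impI)
    fix chi :: real and Y0 X0 :: "nat pmf" and \<eta> :: real
    assume chi: "0 < chi" "chi \<le> 1" and Y2: "measure_pmf.prob Y0 {2..} > 0"
      and fin: "Lambda m Y0 < \<infinity>"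
      and crit: "(real m - 1) * expec Y0 (\<lambda>z. real z * real m ^ z) = expec Y0 (\<lambda>z. real m ^ z)"
      and dom: "\<forall>k::nat. k \<ge> 1 \<longrightarrow> pmf X0 k \<ge> pmf Y0 k"
      and \<eta>: "0 < \<eta>" "\<eta> \<le> 1 / (3 * (real m - 1))"
      and EX: "Enat X0 \<ge> Enat Y0 + ennreal \<eta>"
    define \<Lambda> where "\<Lambda> = enn2real (Lambda m Y0)"
    define R where "R = \<Lambda> / (\<eta> * chi * pmf Y0 0)"
    define M where "M = max (\<Lambda> * (R * ln R) powr ((1 - \<beta>) / 2)) ((R * ln R) powr (1 / 2)) * ln R
                / sqrt (chi ^ 3 * pmf Y0 0)"
    have p0: "pmf Y0 0 > 0" by (rule pmf_0_pos[OF m fin crit Y2])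
    have p1: "pmf Y0 0 \<le> 1" by (rule pmf_le_1)
    have \<Lambda>1: "1 \<le> (real m - 1) * \<Lambda>" unfolding \<Lambda>_def by (rule Lambda_ge[OF m fin crit])
    \<comment> \<open>As this product is at most one, \<open>R\<close> is at least
      \<open>\<Lambda> / \<eta>\<close>, the ratio that \<open>mean_reaches_two\<close> asks
      for.\<close>
    have cp: "0 < chi * pmf Y0 0" "chi * pmf Y0 0 \<le> 1"
      using chi p0 p1 by (auto simp: mult_le_one)
    have "\<Lambda> \<ge> 0" by (simp add: \<Lambda>_def)
    then have "\<Lambda> / \<eta> \<le> \<Lambda> / \<eta> / (chi * pmf Y0 0)"
      using cp \<eta>(1) by (simp add: le_divide_eq mult_left_le)
    then have R_ge: "\<Lambda> / \<eta> \<le> R" by (simp add: R_def mult.assoc)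
    have m1: "real m - 1 \<ge> 1" using m by simp
    \<comment> \<open>Together with \<open>\<Lambda> \<ge> 1 / (m - 1)\<close>, the upper bound on
      \<open>\<eta>\<close> gives \<open>R \<ge> 3\<close>.\<close>
    have "3 * (real m - 1) * \<eta> \<le> 1" using \<eta>(2) m1 by (simp add: le_divide_eq mult.commute)
    then have "(real m - 1) * (3 * \<eta>) \<le> (real m - 1) * \<Lambda>" using \<Lambda>1 by (simp add: mult_ac)
    then have "3 * \<eta> \<le> \<Lambda>" using m1 by simp
    then have "3 \<le> \<Lambda> / \<eta>" using \<eta>(1) by (simp add: le_divide_eq)
    then have R3: "R \<ge> 3" using R_ge by linarith
    have "1 / (3 * (real m - 1)) \<le> 1" using m1 by simp
    then have \<eta>1: "\<eta> \<le> 1" using \<eta>(2) by linarith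
    have LR: "\<Lambda> \<le> R * \<eta>" using R_ge \<eta>(1) by (simp add: divide_le_eq)
    obtain j where j: "real j \<le> C * (sqrt (R * ln R) * ln R)" "Enat (rs m X0 j) \<ge> 2"
      using C(2)[OF fin crit _ \<eta>(1) \<eta>1 EX R3] dom LR unfolding \<Lambda>_def by blast
    have lnR: "ln R \<ge> 0" using R3 by simp
    have sq: "sqrt (chi ^ 3 * pmf Y0 0) \<le> 1" "sqrt (chi ^ 3 * pmf Y0 0) > 0"
      using chi p0 p1 by (auto simp: mult_le_one power_le_one)
    \<comment> \<open>The square root is the second entry of the maximum, and the prefactor
      \<open>1 / sqrt (chi ^ 3 * pmf Y0 0)\<close> is at least one.\<close>
    have "sqrt (R * ln R) * ln R \<le> max (\<Lambda> * (R * ln R) powr ((1 - \<beta>) / 2)) ((R * ln R) powr (1 / 2)) * ln R"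
      using lnR R3 by (intro mult_right_mono) (auto simp: powr_half_sqrt)
    also have "\<dots> \<le> M"
    proof -
      have "max (\<Lambda> * (R * ln R) powr ((1 - \<beta>) / 2)) ((R * ln R) powr (1 / 2)) * ln R \<ge> 0"
        using lnR by (intro mult_nonneg_nonneg) (auto simp: le_max_iff_disj)
      then show ?thesis unfolding M_def using sq by (simp add: le_divide_eq mult_left_le)
    qed
    finally have "C * (sqrt (R * ln R) * ln R) \<le> C * M" using C(1) by (intro mult_left_mono) auto
    then have jM: "real j \<le> C * M" using j(1) by linarith
    then have jn: "j \<le> nat \<lfloor>C * M\<rfloor>" by (simp add: le_nat_floor)
    have "exp (- (C * ln (real m)) * M) \<le> 1 / real m ^ j"
    proof -
      have "real j * ln (real m) \<le> (C * M) * ln (real m)" using jM lnm by (intro mult_right_mono) auto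
      then have "exp (- (C * ln (real m)) * M) \<le> exp (- (real j * ln (real m)))" by (simp add: mult_ac)
      also have "\<dots> = 1 / real m ^ j" using m by (simp add: exp_minus exp_of_nat_mult inverse_eq_divide)
      finally show ?thesis .
    qed
    then have "ennreal (exp (- (C * ln (real m)) * M)) \<le> free_energy m X0"
      using free_energy_ge[OF m j(2)] by (meson ennreal_leI order_trans)
    with jn j(2) show "let \<Lambda> = enn2real (Lambda m Y0);
         R = \<Lambda> / (\<eta> * chi * pmf Y0 0);
         M = max (\<Lambda> * (R * ln R) powr ((1 - \<beta>) / 2)) ((R * ln R) powr (1 / 2)) * ln R
                / sqrt (chi ^ 3 * pmf Y0 0);
         n0 = nat \<lfloor>C * M\<rfloor>
     in (\<exists>j \<le> n0. Enat (rs m X0 j) \<ge> 2) \<and>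
        free_energy m X0 \<ge> ennreal (exp (- (C * ln (real m)) * M))"
      unfolding Let_def M_def R_def \<Lambda>_def by blast
  qed (use C(1) lnm in auto)
qed

end
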